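(* Let $\acute N$ be a screen transversal anti-invariant lightlike submanifold of a locally metallic semi-Riemannian manifold $(\breve N,\breve g,\breve J)$. Then the radical distribution $Rad(T\acute N)$ defines a totally geodesic foliation if and only if, for all $W,U\in\Gamma(Rad(T\acute N))$, there is no component of $\nabla^s_W\breve JU-p\,h^s(W,U)$ in $\breve JS(T\acute N)$.
   Context: Fix positive integers $p,q$. A metallic semi-Riemannian manifold $(\breve N,\breve g,\breve J)$ is a semi-Riemannian manifold $(\breve N,\breve g)$ with a $(1,1)$-tensor field $\breve J$ such that $\breve J^2=p\breve J+qI$ and $\breve g(\breve JW,U)=\breve g(W,\breve JU)$ for all vector fields $W,U$ on $\breve N$. It is locally metallic if $\breve\nabla\breve J=0$, where $\breve\nabla$ is the Levi-Civita connection of $\breve g$. A submanifold $\acute N$ of dimension $m$ in $\breve N$ is lightlike if the metric $g$ induced from $\breve g$ is degenerate and $Rad(T\acute N)=T\acute N\cap T\acute N^{\perp}$ is a distribution of constant rank $r$, $1\le r\le m$. Fix a screen distribution $S(T\acute N)$ (non-degenerate complement of $Rad(T\acute N)$ in $T\acute N$), a screen transversal bundle $S(T\acute N^{\perp})$ (non-degenerate complement of $Rad(T\acute N)$ in $T\acute N^{\perp}$), and the associated lightlike transversal bundle $ltr(T\acute N)$: it is orthogonal to $S(T\acute N)$ and $S(T\acute N^\perp)$, and for any local basis $\{\xi_i\}$ of $Rad(T\acute N)$ it is locally spanned by $\{N_i\}$ with $\breve g(\xi_i,N_j)=\delta_{ij}$, $\breve g(N_i,N_j)=0$. With $\oplus_{ort}$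 denoting orthogonal direct sum, $T\breve N|_{\acute N}=S(T\acute N)\oplus_{ort}[Rad(T\acute N)\oplus ltr(T\acute N)]\oplus_{ort}S(T\acute N^{\perp})$. For $W,U\in\Gamma(T\acute N)$ and $Z\in\Gamma(S(T\acute N^\perp))$ write $\breve\nabla_WU=\nabla_WU+h^{\ell}(W,U)+h^s(W,U)$ and $\breve\nabla_WZ=-A_ZW+\nabla^s_WZ+D^{\ell}(W,Z)$, where $\nabla_WU,A_ZW\in\Gamma(T\acute N)$, $h^\ell(W,U),D^\ell(W,Z)\in\Gamma(ltr(T\acute N))$ and $h^s(W,U),\nabla^s_WZ\in\Gamma(S(T\acute N^\perp))$. The radical distribution defines a totally geodesic foliation if $\nabla_WU\in\Gamma(Rad(T\acute N))$ for all $W,U\in\Gamma(Rad(T\acute N))$, equivalently $g(\nabla_WU,Z)=0$ for all such $W,U$ and all $Z\in\Gamma(S(T\acute N))$. $\acute N$ is screen transversal anti-invariant if $\breve J\,Rad(T\acute N)\subset S(T\acute N^{\perp})$ and $\breve J\,S(T\acute N)\subset S(T\acute N^{\perp})$. A section $X$ has no component in $\breve JS(T\acute N)$ if $\breve g(X,\breve JZ)=0$ for all $Z\in\Gamma(S(T\acute N))$. *)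

theory Defs
  imports "HOL-Analysis.Analysis"
begin

section \<open>Smooth manifolds\<close>

text \<open>\<open>cdiff_on n S f\<close>: \<open>f\<close> is of class \<open>C^n\<close> on the open set \<open>S\<close>.\<close>

primrec cdiff_on :: "nat \<Rightarrow> 'a::euclidean_space set \<Rightarrow> ('a \<Rightarrow> 'b::real_normed_vector) \<Rightarrow> bool" where
  "cdiff_on 0 S f \<longleftrightarrow> continuous_on S f"
| "cdiff_on (Suc n) S f \<longleftrightarrow>
     (\<forall>x\<in>S. f differentiable (at x)) \<and>
     (\<forall>v. cdiff_on n S (\<lambda>x. frechet_derivative f (at x) v))"

definition smooth_on :: "'a::euclidean_space set \<Rightarrow> ('a \<Rightarrow> 'b::real_normed_vector) \<Rightarrow> bool" where
  "smooth_on S f \<longleftrightarrow> (\<forall>n. cdiff_on n S f)"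

text \<open>A chart is its domain together with its coordinate map, whose values off the domain
  are irrelevant. A manifold is a type with a Hausdorff, second countable topology and a smooth
  atlas; its dimension is the dimension of the model space.\<close>

type_synonym ('m, 'e) chart = "'m set \<times> ('m \<Rightarrow> 'e)"

definition chart_inv :: "('m, 'e) chart \<Rightarrow> 'e \<Rightarrow> 'm" where
  "chart_inv c = inv_into (fst c) (snd c)"

definition smooth_atlas ::
    "('m::{t2_space, second_countable_topology}, 'e::euclidean_space) chart set \<Rightarrow> bool" where
  "smooth_atlas A \<longleftrightarrow>
     (\<Union>c\<in>A. fst c) = UNIV \<and>
     (\<forall>c\<in>A. open (fst c) \<and> open (snd c ` fst c) \<and>
        homeomorphism (fst c) (snd c ` fst c) (snd c) (chart_inv c)) \<and>
     (\<forall>c\<in>A. \<forall>d\<in>A. smooth_on (snd c ` (fst c \<inter> fst d)) (snd d \<circ> chart_inv c))"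

text \<open>Tangent vectors at \<open>x\<close> are represented by their coordinates in a preferred chart at \<open>x\<close>,
  so that every tangent space is a copy of the model space. The preferred charts need not vary
  continuously with \<open>x\<close>: smoothness of a field of tangent vectors is therefore always
  expressed through its coordinates in a fixed chart of the atlas.\<close>

definition chart_at :: "('m, 'e) chart set \<Rightarrow> 'm \<Rightarrow> ('m, 'e) chart" where
  "chart_at A x = (SOME c. c \<in> A \<and> x \<in> fst c)"

text \<open>Derivative at \<open>x\<close> of a vector-valued function \<open>h\<close> in the direction of the tangent vector
  \<open>v\<close>. If \<open>h\<close> is the coordinate map of a chart, this is the coordinate expression of \<open>v\<close> in
  that chart.\<close>

definition mderiv ::
    "('m, 'e::euclidean_space) chart set \<Rightarrow> ('m \<Rightarrow> 'v::real_normed_vector) \<Rightarrow> 'm \<Rightarrow> 'e \<Rightarrow> 'v" where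
  "mderiv A h x v =
     frechet_derivative (h \<circ> chart_inv (chart_at A x)) (at (snd (chart_at A x) x)) v"

definition msmooth_on ::
    "('m, 'e::euclidean_space) chart set \<Rightarrow> 'm set \<Rightarrow> ('m \<Rightarrow> 'v::real_normed_vector) \<Rightarrow> bool" where
  "msmooth_on A S h \<longleftrightarrow> (\<forall>c\<in>A. smooth_on (snd c ` (S \<inter> fst c)) (h \<circ> chart_inv c))"

abbreviation smooth_functions :: "('m, 'e::euclidean_space) chart set \<Rightarrow> ('m \<Rightarrow> real) set" where
  "smooth_functions A \<equiv> {h. msmooth_on A UNIV h}"

definition smooth_map ::
    "('n::topological_space, 'k::euclidean_space) chart set \<Rightarrow>
     ('m::topological_space, 'e::euclidean_space) chart set \<Rightarrow> ('n \<Rightarrow> 'm) \<Rightarrow> bool" where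
  "smooth_map B A f \<longleftrightarrow>
     continuous_on UNIV f \<and> (\<forall>c\<in>A. msmooth_on B (f -` fst c) (snd c \<circ> f))"

definition differential ::
    "('n, 'k::euclidean_space) chart set \<Rightarrow> ('m, 'e::euclidean_space) chart set \<Rightarrow>
     ('n \<Rightarrow> 'm) \<Rightarrow> 'n \<Rightarrow> 'k \<Rightarrow> 'e" where
  "differential B A f x v = mderiv B (snd (chart_at A (f x)) \<circ> f) x v"

text \<open>Smooth sections, over the open set \<open>V\<close>, of the pullback along \<open>f\<close> of the tangent bundle of
  the target: \<open>X x\<close> is a tangent vector at \<open>f x\<close>.\<close>

definition section_on ::
    "('n, 'k::euclidean_space) chart set \<Rightarrow> ('m, 'e::euclidean_space) chart set \<Rightarrow>
     ('n \<Rightarrow> 'm) \<Rightarrow> 'n set \<Rightarrow> ('n \<Rightarrow> 'e) \<Rightarrow> bool" where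
  "section_on B A f V X \<longleftrightarrow>
     (\<forall>c\<in>A. msmooth_on B (V \<inter> f -` fst c) (\<lambda>x. mderiv A (snd c) (f x) (X x)))"

abbreviation vector_fields :: "('m, 'e::euclidean_space) chart set \<Rightarrow> ('m \<Rightarrow> 'e) set" where
  "vector_fields A \<equiv> {X. section_on A A (\<lambda>x. x) UNIV X}"

section \<open>Metallic semi-Riemannian manifolds\<close>

definition form_index :: "('e::euclidean_space \<Rightarrow> 'e \<Rightarrow> real) \<Rightarrow> nat" where
  "form_index b = Max {dim S | S. subspace S \<and> (\<forall>v\<in>S. v \<noteq> 0 \<longrightarrow> b v v < 0)}"

text \<open>Tensor fields act pointwise on tangent vectors; smoothness means that they map smooth vector
  fields to smooth functions or smooth vector fields.\<close>

definition semi_riemannian_manifold ::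
    "('m::{t2_space, second_countable_topology}, 'e::euclidean_space) chart set \<Rightarrow>
     ('m \<Rightarrow> 'e \<Rightarrow> 'e \<Rightarrow> real) \<Rightarrow> bool" where
  "semi_riemannian_manifold A g \<longleftrightarrow>
     smooth_atlas A \<and>
     (\<forall>x. bilinear (g x)) \<and>
     (\<forall>x v w. g x v w = g x w v) \<and>
     (\<forall>x v. (\<forall>w. g x v w = 0) \<longrightarrow> v = 0) \<and>
     (\<forall>x y. form_index (g x) = form_index (g y)) \<and>
     (\<forall>X\<in>vector_fields A. \<forall>Y\<in>vector_fields A. (\<lambda>x. g x (X x) (Y x)) \<in> smooth_functions A)"

definition metallic_semi_riemannian_manifold ::
    "nat \<Rightarrow> nat \<Rightarrow> ('m::{t2_space, second_countable_topology}, 'e::euclidean_space) chart set \<Rightarrow>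
     ('m \<Rightarrow> 'e \<Rightarrow> 'e \<Rightarrow> real) \<Rightarrow> ('m \<Rightarrow> 'e \<Rightarrow> 'e) \<Rightarrow> bool" where
  "metallic_semi_riemannian_manifold p q A g J \<longleftrightarrow>
     semi_riemannian_manifold A g \<and>
     (\<forall>x. linear (J x)) \<and>
     (\<forall>X\<in>vector_fields A. (\<lambda>x. J x (X x)) \<in> vector_fields A) \<and>
     (\<forall>x v. J x (J x v) = real p *\<^sub>R J x v + real q *\<^sub>R v) \<and>
     (\<forall>x v w. g x (J x v) w = g x v (J x w))"

definition affine_connection ::
    "('m, 'e::euclidean_space) chart set \<Rightarrow>
     (('m \<Rightarrow> 'e) \<Rightarrow> ('m \<Rightarrow> 'e) \<Rightarrow> 'm \<Rightarrow> 'e) \<Rightarrow> bool" where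
  "affine_connection A D \<longleftrightarrow>
     (\<forall>X\<in>vector_fields A. \<forall>Y\<in>vector_fields A. D X Y \<in> vector_fields A) \<and>
     (\<forall>X\<in>vector_fields A. \<forall>X'\<in>vector_fields A. \<forall>Y\<in>vector_fields A. \<forall>x.
        D (\<lambda>y. X y + X' y) Y x = D X Y x + D X' Y x) \<and>
     (\<forall>h\<in>smooth_functions A. \<forall>X\<in>vector_fields A. \<forall>Y\<in>vector_fields A. \<forall>x.
        D (\<lambda>y. h y *\<^sub>R X y) Y x = h x *\<^sub>R D X Y x) \<and>
     (\<forall>X\<in>vector_fields A. \<forall>Y\<in>vector_fields A. \<forall>Y'\<in>vector_fields A. \<forall>x.
        D X (\<lambda>y. Y y + Y' y) x = D X Y x + D X Y' x) \<and>
     (\<forall>h\<in>smooth_functions A. \<forall>X\<in>vector_fields A. \<forall>Y\<in>vector_fields A. \<forall>x.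
        D X (\<lambda>y. h y *\<^sub>R Y y) x = mderiv A h x (X x) *\<^sub>R Y x + h x *\<^sub>R D X Y x)"

text \<open>The second conjunct says that \<open>D\<close> is torsion-free, with the Lie bracket \<open>[X, Y]\<close> expressed
  through its action \<open>h \<mapsto> X (Y h) - Y (X h)\<close> on smooth functions.\<close>

definition levi_civita_connection ::
    "('m, 'e::euclidean_space) chart set \<Rightarrow> ('m \<Rightarrow> 'e \<Rightarrow> 'e \<Rightarrow> real) \<Rightarrow>
     (('m \<Rightarrow> 'e) \<Rightarrow> ('m \<Rightarrow> 'e) \<Rightarrow> 'm \<Rightarrow> 'e) \<Rightarrow> bool" where
  "levi_civita_connection A g D \<longleftrightarrow>
     affine_connection A D \<and>
     (\<forall>X\<in>vector_fields A. \<forall>Y\<in>vector_fields A. \<forall>h\<in>smooth_functions A. \<forall>x.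
        mderiv A h x (D X Y x) - mderiv A h x (D Y X x) =
        mderiv A (\<lambda>y. mderiv A h y (Y y)) x (X x) - mderiv A (\<lambda>y. mderiv A h y (X y)) x (Y x)) \<and>
     (\<forall>X\<in>vector_fields A. \<forall>Y\<in>vector_fields A. \<forall>Z\<in>vector_fields A. \<forall>x.
        mderiv A (\<lambda>y. g y (Y y) (Z y)) x (X x) = g x (D X Y x) (Z x) + g x (Y x) (D X Z x))"

definition locally_metallic ::
    "nat \<Rightarrow> nat \<Rightarrow> ('m::{t2_space, second_countable_topology}, 'e::euclidean_space) chart set \<Rightarrow>
     ('m \<Rightarrow> 'e \<Rightarrow> 'e \<Rightarrow> real) \<Rightarrow> ('m \<Rightarrow> 'e \<Rightarrow> 'e) \<Rightarrow>
     (('m \<Rightarrow> 'e) \<Rightarrow> ('m \<Rightarrow> 'e) \<Rightarrow> 'm \<Rightarrow> 'e) \<Rightarrow> bool" where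
  "locally_metallic p q A g J D \<longleftrightarrow>
     metallic_semi_riemannian_manifold p q A g J \<and>
     levi_civita_connection A g D \<and>
     (\<forall>X\<in>vector_fields A. \<forall>Y\<in>vector_fields A. \<forall>x.
        D X (\<lambda>y. J y (Y y)) x - J x (D X Y x) = 0)"

section \<open>Lightlike submanifolds\<close>

text \<open>The submanifold is given by an injective immersion \<open>f\<close> and is equipped with its own smooth
  structure \<open>B\<close>. Its tangent spaces are regarded as subspaces of those of the ambient manifold.\<close>

definition immersed_submanifold ::
    "('n::{t2_space, second_countable_topology}, 'k::euclidean_space) chart set \<Rightarrow>
     ('m::{t2_space, second_countable_topology}, 'e::euclidean_space) chart set \<Rightarrow>
     ('n \<Rightarrow> 'm) \<Rightarrow> bool" where
  "immersed_submanifold B A f \<longleftrightarrow>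
     smooth_atlas B \<and> smooth_map B A f \<and> inj f \<and> (\<forall>x. inj (differential B A f x))"

definition tangent_bundle ::
    "('n, 'k::euclidean_space) chart set \<Rightarrow> ('m, 'e::euclidean_space) chart set \<Rightarrow>
     ('n \<Rightarrow> 'm) \<Rightarrow> 'n \<Rightarrow> 'e set" where
  "tangent_bundle B A f x = range (differential B A f x)"

definition normal_bundle ::
    "('n, 'k::euclidean_space) chart set \<Rightarrow> ('m, 'e::euclidean_space) chart set \<Rightarrow>
     ('m \<Rightarrow> 'e \<Rightarrow> 'e \<Rightarrow> real) \<Rightarrow> ('n \<Rightarrow> 'm) \<Rightarrow> 'n \<Rightarrow> 'e set" where
  "normal_bundle B A g f x = {v. \<forall>w\<in>tangent_bundle B A f x. g (f x) v w = 0}"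

definition rad_bundle ::
    "('n, 'k::euclidean_space) chart set \<Rightarrow> ('m, 'e::euclidean_space) chart set \<Rightarrow>
     ('m \<Rightarrow> 'e \<Rightarrow> 'e \<Rightarrow> real) \<Rightarrow> ('n \<Rightarrow> 'm) \<Rightarrow> 'n \<Rightarrow> 'e set" where
  "rad_bundle B A g f x = tangent_bundle B A f x \<inter> normal_bundle B A g f x"

definition local_frame ::
    "('n::topological_space, 'k::euclidean_space) chart set \<Rightarrow>
     ('m, 'e::euclidean_space) chart set \<Rightarrow> ('n \<Rightarrow> 'm) \<Rightarrow> ('n \<Rightarrow> 'e set) \<Rightarrow> nat \<Rightarrow>
     'n set \<Rightarrow> (nat \<Rightarrow> 'n \<Rightarrow> 'e) \<Rightarrow> bool" where
  "local_frame B A f E k V e \<longleftrightarrow>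
     open V \<and> (\<forall>i<k. section_on B A f V (e i)) \<and>
     (\<forall>x\<in>V. inj_on (\<lambda>i. e i x) {..<k} \<and> independent ((\<lambda>i. e i x) ` {..<k}) \<and>
        span ((\<lambda>i. e i x) ` {..<k}) = E x)"

text \<open>\<open>E\<close> is a smooth rank \<open>k\<close> subbundle of the ambient tangent bundle restricted to the
  submanifold.\<close>

definition subbundle ::
    "('n::topological_space, 'k::euclidean_space) chart set \<Rightarrow>
     ('m, 'e::euclidean_space) chart set \<Rightarrow> ('n \<Rightarrow> 'm) \<Rightarrow> ('n \<Rightarrow> 'e set) \<Rightarrow> nat \<Rightarrow> bool" where
  "subbundle B A f E k \<longleftrightarrow> (\<forall>x. \<exists>V e. x \<in> V \<and> local_frame B A f E k V e)"

definition sections ::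
    "('n, 'k::euclidean_space) chart set \<Rightarrow> ('m, 'e::euclidean_space) chart set \<Rightarrow>
     ('n \<Rightarrow> 'm) \<Rightarrow> ('n \<Rightarrow> 'e set) \<Rightarrow> ('n \<Rightarrow> 'e) set" where
  "sections B A f E = {X. section_on B A f UNIV X \<and> (\<forall>x. X x \<in> E x)}"

definition lightlike_submanifold ::
    "('n::{t2_space, second_countable_topology}, 'k::euclidean_space) chart set \<Rightarrow>
     ('m::{t2_space, second_countable_topology}, 'e::euclidean_space) chart set \<Rightarrow>
     ('m \<Rightarrow> 'e \<Rightarrow> 'e \<Rightarrow> real) \<Rightarrow> ('n \<Rightarrow> 'm) \<Rightarrow> nat \<Rightarrow> bool" where
  "lightlike_submanifold B A g f r \<longleftrightarrow>
     immersed_submanifold B A f \<and>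
     (\<forall>x. \<exists>v\<in>tangent_bundle B A f x. v \<noteq> 0 \<and> (\<forall>w\<in>tangent_bundle B A f x. g (f x) v w = 0)) \<and>
     subbundle B A f (rad_bundle B A g f) r \<and> 1 \<le> r \<and> r \<le> DIM('k)"

definition complement_in :: "'e::euclidean_space set \<Rightarrow> 'e set \<Rightarrow> 'e set \<Rightarrow> bool" where
  "complement_in T E F \<longleftrightarrow> E \<inter> F = {0} \<and> {u + v | u v. u \<in> E \<and> v \<in> F} = T"

definition nondegenerate_on :: "('e \<Rightarrow> 'e \<Rightarrow> real) \<Rightarrow> 'e::euclidean_space set \<Rightarrow> bool" where
  "nondegenerate_on b E \<longleftrightarrow> (\<forall>v\<in>E. (\<forall>w\<in>E. b v w = 0) \<longrightarrow> v = 0)"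

definition screen_distribution ::
    "('n::topological_space, 'k::euclidean_space) chart set \<Rightarrow>
     ('m, 'e::euclidean_space) chart set \<Rightarrow> ('m \<Rightarrow> 'e \<Rightarrow> 'e \<Rightarrow> real) \<Rightarrow> ('n \<Rightarrow> 'm) \<Rightarrow>
     ('n \<Rightarrow> 'e set) \<Rightarrow> bool" where
  "screen_distribution B A g f S \<longleftrightarrow>
     (\<exists>k. subbundle B A f S k) \<and>
     (\<forall>x. complement_in (tangent_bundle B A f x) (S x) (rad_bundle B A g f x) \<and>
          nondegenerate_on (g (f x)) (S x))"

definition screen_transversal_bundle ::
    "('n::topological_space, 'k::euclidean_space) chart set \<Rightarrow>
     ('m, 'e::euclidean_space) chart set \<Rightarrow> ('m \<Rightarrow> 'e \<Rightarrow> 'e \<Rightarrow> real) \<Rightarrow> ('n \<Rightarrow> 'm) \<Rightarrow>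
     ('n \<Rightarrow> 'e set) \<Rightarrow> bool" where
  "screen_transversal_bundle B A g f St \<longleftrightarrow>
     (\<exists>k. subbundle B A f St k) \<and>
     (\<forall>x. complement_in (normal_bundle B A g f x) (St x) (rad_bundle B A g f x) \<and>
          nondegenerate_on (g (f x)) (St x))"

definition lightlike_transversal_bundle ::
    "('n::topological_space, 'k::euclidean_space) chart set \<Rightarrow>
     ('m, 'e::euclidean_space) chart set \<Rightarrow> ('m \<Rightarrow> 'e \<Rightarrow> 'e \<Rightarrow> real) \<Rightarrow> ('n \<Rightarrow> 'm) \<Rightarrow> nat \<Rightarrow>
     ('n \<Rightarrow> 'e set) \<Rightarrow> ('n \<Rightarrow> 'e set) \<Rightarrow> ('n \<Rightarrow> 'e set) \<Rightarrow> bool" where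
  "lightlike_transversal_bundle B A g f r S St L \<longleftrightarrow>
     subbundle B A f L r \<and>
     (\<forall>x. \<forall>v\<in>L x. (\<forall>w\<in>S x. g (f x) v w = 0) \<and> (\<forall>w\<in>St x. g (f x) v w = 0)) \<and>
     (\<forall>V \<xi>. local_frame B A f (rad_bundle B A g f) r V \<xi> \<longrightarrow>
        (\<exists>N. local_frame B A f L r V N \<and>
          (\<forall>x\<in>V. \<forall>i<r. \<forall>j<r.
             g (f x) (\<xi> i x) (N j x) = (if i = j then 1 else 0) \<and>
             g (f x) (N i x) (N j x) = 0)))"

section \<open>The Gauss and Weingarten formulas\<close>

text \<open>The operator \<open>D\<close> acts on vector fields of the ambient manifold; covariant derivatives along the
  submanifold use the unique connection that \<open>D\<close> induces on the restricted ambient tangent bundle.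
  Fields tangent to the submanifold are sections of \<open>tangent_bundle\<close>, so the derivative \<open>W h\<close>
  of a function \<open>h\<close> on the submanifold is taken along the preimage of \<open>W\<close> under the differential.
  The last conjunct is agreement with \<open>D\<close> on fields that extend to the ambient manifold.\<close>

definition induced_connection ::
    "('n, 'k::euclidean_space) chart set \<Rightarrow> ('m, 'e::euclidean_space) chart set \<Rightarrow> ('n \<Rightarrow> 'm) \<Rightarrow>
     (('m \<Rightarrow> 'e) \<Rightarrow> ('m \<Rightarrow> 'e) \<Rightarrow> 'm \<Rightarrow> 'e) \<Rightarrow>
     (('n \<Rightarrow> 'e) \<Rightarrow> ('n \<Rightarrow> 'e) \<Rightarrow> 'n \<Rightarrow> 'e) \<Rightarrow> bool" where
  "induced_connection B A f D Df \<longleftrightarrow>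
     (let \<Gamma>T = sections B A f (tangent_bundle B A f); \<Gamma> = sections B A f (\<lambda>x. UNIV) in
     (\<forall>W\<in>\<Gamma>T. \<forall>U\<in>\<Gamma>. Df W U \<in> \<Gamma>) \<and>
     (\<forall>W\<in>\<Gamma>T. \<forall>W'\<in>\<Gamma>T. \<forall>U\<in>\<Gamma>. \<forall>x. Df (\<lambda>y. W y + W' y) U x = Df W U x + Df W' U x) \<and>
     (\<forall>h\<in>smooth_functions B. \<forall>W\<in>\<Gamma>T. \<forall>U\<in>\<Gamma>. \<forall>x. Df (\<lambda>y. h y *\<^sub>R W y) U x = h x *\<^sub>R Df W U x) \<and>
     (\<forall>W\<in>\<Gamma>T. \<forall>U\<in>\<Gamma>. \<forall>U'\<in>\<Gamma>. \<forall>x. Df W (\<lambda>y. U y + U' y) x = Df W U x + Df W U' x) \<and>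
     (\<forall>h\<in>smooth_functions B. \<forall>W\<in>\<Gamma>T. \<forall>U\<in>\<Gamma>. \<forall>x.
        Df W (\<lambda>y. h y *\<^sub>R U y) x =
        mderiv B h x (inv (differential B A f x) (W x)) *\<^sub>R U x + h x *\<^sub>R Df W U x) \<and>
     (\<forall>W\<in>\<Gamma>T. \<forall>X\<in>vector_fields A. \<forall>Y\<in>vector_fields A. \<forall>x.
        X (f x) = W x \<longrightarrow> Df W (\<lambda>y. Y (f y)) x = D X Y (f x)))"

definition gauss_weingarten ::
    "('n, 'k::euclidean_space) chart set \<Rightarrow> ('m, 'e::euclidean_space) chart set \<Rightarrow> ('n \<Rightarrow> 'm) \<Rightarrow>
     ('n \<Rightarrow> 'e set) \<Rightarrow> ('n \<Rightarrow> 'e set) \<Rightarrow>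
     (('n \<Rightarrow> 'e) \<Rightarrow> ('n \<Rightarrow> 'e) \<Rightarrow> 'n \<Rightarrow> 'e) \<Rightarrow>
     (('n \<Rightarrow> 'e) \<Rightarrow> ('n \<Rightarrow> 'e) \<Rightarrow> 'n \<Rightarrow> 'e) \<Rightarrow>
     (('n \<Rightarrow> 'e) \<Rightarrow> ('n \<Rightarrow> 'e) \<Rightarrow> 'n \<Rightarrow> 'e) \<Rightarrow>
     (('n \<Rightarrow> 'e) \<Rightarrow> ('n \<Rightarrow> 'e) \<Rightarrow> 'n \<Rightarrow> 'e) \<Rightarrow>
     (('n \<Rightarrow> 'e) \<Rightarrow> ('n \<Rightarrow> 'e) \<Rightarrow> 'n \<Rightarrow> 'e) \<Rightarrow>
     (('n \<Rightarrow> 'e) \<Rightarrow> ('n \<Rightarrow> 'e) \<Rightarrow> 'n \<Rightarrow> 'e) \<Rightarrow>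
     (('n \<Rightarrow> 'e) \<Rightarrow> ('n \<Rightarrow> 'e) \<Rightarrow> 'n \<Rightarrow> 'e) \<Rightarrow> bool" where
  "gauss_weingarten B A f St L Df nab hl hs sh nabs Dl \<longleftrightarrow>
     (let \<Gamma>T = sections B A f (tangent_bundle B A f);
          \<Gamma>L = sections B A f L; \<Gamma>St = sections B A f St in
     (\<forall>W\<in>\<Gamma>T. \<forall>U\<in>\<Gamma>T.
        nab W U \<in> \<Gamma>T \<and> hl W U \<in> \<Gamma>L \<and> hs W U \<in> \<Gamma>St \<and>
        (\<forall>x. Df W U x = nab W U x + hl W U x + hs W U x)) \<and>
     (\<forall>W\<in>\<Gamma>T. \<forall>Z\<in>\<Gamma>St.
        sh Z W \<in> \<Gamma>T \<and> nabs W Z \<in> \<Gamma>St \<and> Dl W Z \<in> \<Gamma>L \<and>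
        (\<forall>x. Df W Z x = - sh Z W x + nabs W Z x + Dl W Z x)))"

definition radical_totally_geodesic ::
    "('n, 'k::euclidean_space) chart set \<Rightarrow> ('m, 'e::euclidean_space) chart set \<Rightarrow>
     ('m \<Rightarrow> 'e \<Rightarrow> 'e \<Rightarrow> real) \<Rightarrow> ('n \<Rightarrow> 'm) \<Rightarrow>
     (('n \<Rightarrow> 'e) \<Rightarrow> ('n \<Rightarrow> 'e) \<Rightarrow> 'n \<Rightarrow> 'e) \<Rightarrow> bool" where
  "radical_totally_geodesic B A g f nab \<longleftrightarrow>
     (\<forall>W\<in>sections B A f (rad_bundle B A g f). \<forall>U\<in>sections B A f (rad_bundle B A g f).
        nab W U \<in> sections B A f (rad_bundle B A g f))"

definition screen_transversal_anti_invariant ::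
    "('n, 'k::euclidean_space) chart set \<Rightarrow> ('m, 'e::euclidean_space) chart set \<Rightarrow>
     ('m \<Rightarrow> 'e \<Rightarrow> 'e \<Rightarrow> real) \<Rightarrow> ('m \<Rightarrow> 'e \<Rightarrow> 'e) \<Rightarrow> ('n \<Rightarrow> 'm) \<Rightarrow>
     ('n \<Rightarrow> 'e set) \<Rightarrow> ('n \<Rightarrow> 'e set) \<Rightarrow> bool" where
  "screen_transversal_anti_invariant B A g J f S St \<longleftrightarrow>
     (\<forall>x. J (f x) ` rad_bundle B A g f x \<subseteq> St x \<and> J (f x) ` S x \<subseteq> St x)"

definition no_component_in_J_screen ::
    "('n, 'k::euclidean_space) chart set \<Rightarrow> ('m, 'e::euclidean_space) chart set \<Rightarrow>
     ('m \<Rightarrow> 'e \<Rightarrow> 'e \<Rightarrow> real) \<Rightarrow> ('m \<Rightarrow> 'e \<Rightarrow> 'e) \<Rightarrow> ('n \<Rightarrow> 'm) \<Rightarrow>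
     ('n \<Rightarrow> 'e set) \<Rightarrow> ('n \<Rightarrow> 'e) \<Rightarrow> bool" where
  "no_component_in_J_screen B A g J f S X \<longleftrightarrow>
     (\<forall>Z\<in>sections B A f S. \<forall>x. g (f x) (X x) (J (f x) (Z x)) = 0)"

end

theory Submission
  imports Defs
begin

text \<open>Let \<open>W\<close> and \<open>U\<close> be sections of the radical distribution and \<open>Z\<close> a section of the screen
distribution \<open>S\<close>. The theorem follows from the pointwise identity

  \<open>g(\<nabla>\<^sup>s\<^sub>W (J U) - p h\<^sup>s(W,U), J Z) = q g(\<nabla>\<^sub>W U, Z)\<close>.

Write \<open>Df\<close> for the connection along the submanifold. As \<open>J\<close> is parallel, self-adjoint and satisfies
\<open>J\<^sup>2 = p J + q I\<close>,

  \<open>g(Df\<^sub>W (J U), J Z) = g(J (Df\<^sub>W U), J Z) = p g(Df\<^sub>W U, J Z) + q g(Df\<^sub>W U, Z)\<close>.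

Both \<open>J U\<close> and \<open>J Z\<close> are sections of the screen transversal bundle, which is orthogonal to the tangent
bundle and to the lightlike transversal bundle. Hence the Weingarten formula reduces the left
hand side to \<open>g(\<nabla>\<^sup>s\<^sub>W (J U), J Z)\<close>, and the Gauss formula reduces the two terms on the right to
\<open>p g(h\<^sup>s(W,U), J Z)\<close> and \<open>q g(\<nabla>\<^sub>W U, Z)\<close>.

As \<open>q \<noteq> 0\<close>, the component condition says that \<open>\<nabla>\<^sub>W U\<close> is orthogonal to all sections of \<open>S\<close>.
If \<open>\<nabla>\<^sub>W U\<close> is radical this is clear. Conversely, sections of \<open>S\<close> attain a spanning set of values
at each point (\<open>linear_vanishes_if_on_sections\<close>), so the \<open>S\<close>-component of \<open>\<nabla>\<^sub>W U\<close> is orthogonal to \<open>S\<close>,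
and vanishes because \<open>S\<close> is non-degenerate.

Two facts about sections along the immersion \<open>f\<close> remain, since \<open>J\<close> is only given as
smooth and parallel on vector fields of the ambient manifold: \<open>J U\<close> is smooth
(\<open>tensor_section\<close>), and \<open>Df\<^sub>W (J U) = J (Df\<^sub>W U)\<close> (\<open>induced_connection_parallel\<close>). Both are reduced to
ambient fields by \<open>section_expansion\<close>, which writes a non-zero multiple of \<open>U\<close> near a point
as a combination of restricted ambient fields. This and the extension of local sections
require smooth bump functions and the elementary calculus of \<open>C^n\<close> maps.\<close>

section \<open>Calculus of smooth maps between Euclidean spaces\<close>

lemma cdiff_on_subset: "cdiff_on n S f \<Longrightarrow> T \<subseteq> S \<Longrightarrow> cdiff_on n T f"
  by (induction n arbitrary: f) (auto intro: continuous_on_subset)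

lemma cdiff_on_imp_continuous_on: "cdiff_on n S f \<Longrightarrow> continuous_on S f"
  by (cases n)
    (auto intro!: differentiable_imp_continuous_on differentiable_at_imp_differentiable_on)

lemma cdiff_on_Suc_imp: "cdiff_on (Suc n) S f \<Longrightarrow> cdiff_on n S f"
proof (induction n arbitrary: f)
  case 0
  then show ?case using cdiff_on_imp_continuous_on[of "Suc 0"] by simp
next
  case (Suc n)
  then show ?case by (metis cdiff_on.simps(2))
qed

lemma cdiff_on_cong:
  assumes "open S" "cdiff_on n S f" "\<And>x. x \<in> S \<Longrightarrow> f x = f' x"
  shows "cdiff_on n S f'"
  using assms(2,3)
proof (induction n arbitrary: f f')
  case 0
  then show ?case by (auto cong: continuous_on_cong)
next
  case (Suc n)
  have d: "(f' has_derivative frechet_derivative f (at x)) (at x)" if "x \<in> S" for x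
  proof (rule has_derivative_transform_within_open[OF _ \<open>open S\<close> that])
    show "(f has_derivative frechet_derivative f (at x)) (at x)"
      using Suc.prems(1) that by (simp add: frechet_derivative_works[symmetric])
  qed (rule Suc.prems(2))
  have "cdiff_on n S (\<lambda>x. frechet_derivative f' (at x) v)" for v
    by (rule Suc.IH[of "\<lambda>x. frechet_derivative f (at x) v"])
      (use Suc.prems in \<open>auto simp: frechet_derivative_at[OF d, symmetric]\<close>)
  then show ?case using d by (auto simp: differentiable_def)
qed

text \<open>Any family of derivatives along \<open>S\<close> may be used to pass from class \<open>C^n\<close> to class \<open>C^(n+1)\<close>.\<close>

lemma cdiff_on_SucI:
  assumes "open S" "\<And>x. x \<in> S \<Longrightarrow> (f has_derivative f' x) (at x)"
    "\<And>v. cdiff_on n S (\<lambda>x. f' x v)"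
  shows "cdiff_on (Suc n) S f"
proof -
  have "cdiff_on n S (\<lambda>x. frechet_derivative f (at x) v)" for v
    by (rule cdiff_on_cong[OF assms(1) assms(3)[of v]])
      (simp add: frechet_derivative_at[OF assms(2)])
  then show ?thesis using assms(2) by (auto simp: differentiable_def)
qed

lemma cdiff_on_SucD:
  assumes "cdiff_on (Suc n) S f"
  shows "x \<in> S \<Longrightarrow> (f has_derivative frechet_derivative f (at x)) (at x)"
    and "cdiff_on n S (\<lambda>x. frechet_derivative f (at x) v)"
  using assms by (auto simp: frechet_derivative_works[symmetric])

lemma cdiff_on_local:
  assumes "\<And>x. x \<in> S \<Longrightarrow> \<exists>U. open U \<and> x \<in> U \<and> cdiff_on n U f"
  shows "cdiff_on n S f"
  using assms
proof (induction n arbitrary: f)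
  case 0
  then show ?case
    by (auto intro!: continuous_at_imp_continuous_on) (metis continuous_on_eq_continuous_at)
next
  case (Suc n)
  have "cdiff_on n S (\<lambda>x. frechet_derivative f (at x) v)" for v
    by (rule Suc.IH) (metis Suc.prems cdiff_on_SucD(2))
  moreover have "f differentiable at x" if "x \<in> S" for x
    using Suc.prems[OF that] by auto
  ultimately show ?case by simp
qed

lemma cdiff_on_const: "cdiff_on n S (\<lambda>x. k)"
proof (induction n arbitrary: k)
  case (Suc n)
  have "frechet_derivative (\<lambda>x::'a. k) (at x) = (\<lambda>_. 0)" for x
    using frechet_derivative_at[OF has_derivative_const] by metis
  then show ?case using Suc by simp
qed simp

lemma cdiff_on_add:
  assumes "open S" "cdiff_on n S f" "cdiff_on n S h"
  shows "cdiff_on n S (\<lambda>x. f x + h x)"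
  using assms(2,3)
proof (induction n arbitrary: f h)
  case 0
  then show ?case by (auto intro: continuous_on_add)
next
  case (Suc n)
  show ?case
    by (rule cdiff_on_SucI[OF assms(1) has_derivative_add
          [OF cdiff_on_SucD(1)[OF Suc.prems(1)] cdiff_on_SucD(1)[OF Suc.prems(2)]]])
      (auto intro!: Suc.IH cdiff_on_SucD(2) Suc.prems simp del: cdiff_on.simps)
qed

lemma cdiff_on_linear:
  assumes "open S" "cdiff_on n S f" "bounded_linear F"
  shows "cdiff_on n S (\<lambda>x. F (f x))"
  using assms(2)
proof (induction n arbitrary: f)
  case 0
  then show ?case using assms(3) by (auto intro: bounded_linear.continuous_on)
next
  case (Suc n)
  show ?case
    by (rule cdiff_on_SucI[OF assms(1) bounded_linear.has_derivative
          [OF assms(3) cdiff_on_SucD(1)[OF Suc.prems]]])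
      (auto intro!: Suc.IH cdiff_on_SucD(2) Suc.prems simp del: cdiff_on.simps)
qed

lemma cdiff_on_scaleR:
  assumes "open S" "cdiff_on n S f" "cdiff_on n S h"
  shows "cdiff_on n S (\<lambda>x. f x *\<^sub>R h x)"
  using assms(2,3)
proof (induction n arbitrary: f h)
  case 0
  then show ?case by (auto intro: continuous_on_scaleR)
next
  case (Suc n)
  show ?case
    by (rule cdiff_on_SucI[OF assms(1) has_derivative_scaleR
          [OF cdiff_on_SucD(1)[OF Suc.prems(1)] cdiff_on_SucD(1)[OF Suc.prems(2)]]])
      (auto intro!: Suc.IH cdiff_on_add[OF assms(1)] cdiff_on_SucD(2) cdiff_on_Suc_imp[OF Suc.prems(1)]
        cdiff_on_Suc_imp[OF Suc.prems(2)] Suc.prems simp del: cdiff_on.simps)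
qed

lemma cdiff_on_sum:
  assumes "open S" "\<And>i. i \<in> I \<Longrightarrow> cdiff_on n S (f i)"
  shows "cdiff_on n S (\<lambda>x. \<Sum>i\<in>I. f i x)"
  using assms(2)
  by (induction I rule: infinite_finite_induct)
    (auto intro: cdiff_on_const cdiff_on_add[OF assms(1)])

text \<open>The chain rule is written with the derivative of \<open>F\<close> expanded over the standard basis, so
that each summand is a product of \<open>C^n\<close> functions to which the induction hypothesis applies.\<close>

lemma cdiff_on_compose:
  fixes k :: "'a::euclidean_space \<Rightarrow> 'b::euclidean_space" and F :: "'b \<Rightarrow> 'c::real_normed_vector"
  assumes "open S" "cdiff_on n T F" "cdiff_on n S k" "k ` S \<subseteq> T"
  shows "cdiff_on n S (\<lambda>x. F (k x))"
  using assms(2,3)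
proof (induction n arbitrary: F)
  case 0
  then show ?case using assms(4) continuous_on_compose2[of T F S k] by simp
next
  case (Suc n)
  let ?F' = "\<lambda>y. frechet_derivative F (at y)" and ?k' = "\<lambda>x. frechet_derivative k (at x)"
  let ?d = "\<lambda>x v. \<Sum>b\<in>Basis. (?k' x v \<bullet> b) *\<^sub>R ?F' (k x) b"
  have "((\<lambda>x. F (k x)) has_derivative ?d x) (at x)" if x: "x \<in> S" for x
  proof -
    have F: "(F has_derivative ?F' (k x)) (at (k x))"
      using cdiff_on_SucD(1)[OF Suc.prems(1)] x assms(4) by blast
    have "((\<lambda>x. F (k x)) has_derivative (\<lambda>v. ?F' (k x) (?k' x v))) (at x)"
      by (rule has_derivative_compose[OF cdiff_on_SucD(1)[OF Suc.prems(2) x] F])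
    moreover have "(\<lambda>v. ?F' (k x) (?k' x v)) = ?d x"
    proof
      interpret linear "?F' (k x)" using F has_derivative_linear by blast
      fix v
      have "?F' (k x) (?k' x v) = ?F' (k x) (\<Sum>b\<in>Basis. (?k' x v \<bullet> b) *\<^sub>R b)"
        by (simp only: euclidean_representation)
      then show "?F' (k x) (?k' x v) = ?d x v" by (simp only: sum scale)
    qed
    ultimately show ?thesis by (rule has_derivative_eq_rhs)
  qed
  moreover have "cdiff_on n S (\<lambda>x. ?d x v)" for v
  proof (intro cdiff_on_sum cdiff_on_scaleR assms(1))
    fix b :: 'b
    show "cdiff_on n S (\<lambda>x. ?k' x v \<bullet> b)"
      by (rule cdiff_on_linear[OF assms(1) cdiff_on_SucD(2)[OF Suc.prems(2)]
            bounded_linear_inner_left])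
    show "cdiff_on n S (\<lambda>x. ?F' (k x) b)"
      by (rule Suc.IH[OF cdiff_on_SucD(2)[OF Suc.prems(1)] cdiff_on_Suc_imp[OF Suc.prems(2)]])
  qed
  ultimately show ?case by (intro cdiff_on_SucI assms(1))
qed

lemma cdiff_on_inverse: "cdiff_on n (- {0}) (inverse :: real \<Rightarrow> real)"
proof (induction n)
  case 0
  then show ?case by (auto intro!: continuous_on_inverse)
next
  case (Suc n)
  have o: "open (- {0::real})" by auto
  have "cdiff_on n (- {0}) (\<lambda>x::real. (- v) *\<^sub>R (inverse x *\<^sub>R inverse x))" for v
    by (intro cdiff_on_scaleR cdiff_on_const o Suc)
  then show ?case
    by (intro cdiff_on_SucI[OF o, where f'="\<lambda>x v. (- v) *\<^sub>R (inverse x *\<^sub>R inverse x)"])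
      (auto intro!: derivative_eq_intros simp: fun_eq_iff)
qed

section \<open>A smooth bump function\<close>

text \<open>The functions \<open>t^(-k) exp (-1/t)\<close> for \<open>t > 0\<close>, extended by \<open>0\<close>. The factor \<open>t^(-k)\<close> makes
the family closed under differentiation, up to linear combinations; the case \<open>k = 0\<close> is the
classical smooth function that is flat at \<open>0\<close>.\<close>

definition flat_exp :: "nat \<Rightarrow> real \<Rightarrow> real" where
  "flat_exp k t = (if t > 0 then inverse t ^ k * exp (- inverse t) else 0)"

lemma flat_exp_tendsto_0: "(flat_exp k \<longlongrightarrow> 0) (at 0)"
proof -
  have "((\<lambda>t. inverse t ^ k / exp (inverse t)) \<longlongrightarrow> 0) (at_right (0::real))"
    by (rule filterlim_compose[OF tendsto_power_div_exp_0 filterlim_inverse_at_top_right])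
  then have "(flat_exp k \<longlongrightarrow> 0) (at_right 0)"
    by (rule Lim_transform_eventually)
      (auto simp: flat_exp_def exp_minus divide_inverse eventually_at_filter)
  moreover have "(flat_exp k \<longlongrightarrow> 0) (at_left 0)"
    by (rule Lim_transform_eventually[OF tendsto_const])
      (auto simp: flat_exp_def eventually_at_filter)
  ultimately show ?thesis by (simp add: filterlim_split_at)
qed

lemma flat_exp_DERIV:
  "(flat_exp k has_field_derivative (flat_exp (k + 2) t - real k * flat_exp (Suc k) t)) (at t)"
proof -
  consider "t > 0" | "t < 0" | "t = 0" by linarith
  then show ?thesis
  proof cases
    case 1
    have "((\<lambda>t. inverse t ^ k * exp (- inverse t)) has_field_derivative
        (flat_exp (k + 2) t - real k * flat_exp (Suc k) t)) (at t)"
    proof (rule DERIV_cong)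
      show "((\<lambda>t. inverse t ^ k * exp (- inverse t)) has_field_derivative
          inverse t ^ k * (exp (- inverse t) * (inverse t * inverse t))
          + (real k * inverse t ^ (k - 1) * - (inverse t * inverse t)) * exp (- inverse t)) (at t)"
        using 1 by (auto intro!: derivative_eq_intros simp: power2_eq_square)
      show "inverse t ^ k * (exp (- inverse t) * (inverse t * inverse t))
          + (real k * inverse t ^ (k - 1) * - (inverse t * inverse t)) * exp (- inverse t)
          = flat_exp (k + 2) t - real k * flat_exp (Suc k) t"
        using 1 by (cases k) (auto simp: flat_exp_def algebra_simps)
    qed
    then show ?thesis
      by (rule has_field_derivative_transform_within_open[where S="{0<..}"])
        (use 1 in \<open>auto simp: flat_exp_def\<close>)
  next
    case 2
    have "((\<lambda>t. 0) has_field_derivative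
        (flat_exp (k + 2) t - real k * flat_exp (Suc k) t)) (at t)"
      using 2 by (auto simp: flat_exp_def)
    then show ?thesis
      by (rule has_field_derivative_transform_within_open[where S="{..<0}"])
        (use 2 in \<open>auto simp: flat_exp_def\<close>)
  next
    case 3
    have "(\<lambda>h. (flat_exp k (0 + h) - flat_exp k 0) / h) = flat_exp (Suc k)"
      by (auto simp: flat_exp_def divide_inverse)
    then have "(flat_exp k has_field_derivative 0) (at 0)"
      unfolding DERIV_def using flat_exp_tendsto_0[of "Suc k"] by simp
    then show ?thesis using 3 by (simp add: flat_exp_def)
  qed
qed

lemma cdiff_on_flat_exp: "cdiff_on n UNIV (flat_exp k)"
proof (induction n arbitrary: k)
  case 0
  show ?case
    using DERIV_isCont[OF flat_exp_DERIV] by (auto intro!: continuous_at_imp_continuous_on)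
next
  case (Suc n)
  let ?D = "\<lambda>t v. flat_exp (k + 2) t *\<^sub>R v + (- real k) *\<^sub>R flat_exp (Suc k) t *\<^sub>R v"
  have "?D t = (*) (flat_exp (k + 2) t - real k * flat_exp (Suc k) t)" for t
    by (auto simp: algebra_simps)
  then have "(flat_exp k has_derivative ?D t) (at t)" for t
    using flat_exp_DERIV[of k t] by (simp only: has_field_derivative_def)
  moreover have "cdiff_on n UNIV (\<lambda>t. ?D t v)" for v
    by (intro cdiff_on_add cdiff_on_scaleR cdiff_on_const open_UNIV Suc)
  ultimately show ?case
    by (intro cdiff_on_SucI open_UNIV)
qed

section \<open>Closure properties of smooth maps\<close>

lemma smooth_on_subset: "smooth_on S f \<Longrightarrow> T \<subseteq> S \<Longrightarrow> smooth_on T f"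
  by (auto simp: smooth_on_def intro: cdiff_on_subset)

lemma smooth_on_cong:
  "open S \<Longrightarrow> smooth_on S f \<Longrightarrow> (\<And>x. x \<in> S \<Longrightarrow> f x = f' x) \<Longrightarrow> smooth_on S f'"
  unfolding smooth_on_def by (metis cdiff_on_cong)

lemma smooth_on_local:
  "(\<And>x. x \<in> S \<Longrightarrow> \<exists>U. open U \<and> x \<in> U \<and> smooth_on U f) \<Longrightarrow> smooth_on S f"
  unfolding smooth_on_def by (metis cdiff_on_local)

lemma smooth_on_imp_has_derivative:
  "smooth_on S f \<Longrightarrow> x \<in> S \<Longrightarrow> (f has_derivative frechet_derivative f (at x)) (at x)"
  unfolding smooth_on_def by (metis cdiff_on_SucD(1))

lemma smooth_on_frechet_derivative:
  "smooth_on S f \<Longrightarrow> smooth_on S (\<lambda>x. frechet_derivative f (at x) v)"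
  unfolding smooth_on_def by (metis cdiff_on_SucD(2))

lemma smooth_on_const: "smooth_on S (\<lambda>x. k)"
  by (simp add: smooth_on_def cdiff_on_const)

lemma smooth_on_add:
  "open S \<Longrightarrow> smooth_on S f \<Longrightarrow> smooth_on S h \<Longrightarrow> smooth_on S (\<lambda>x. f x + h x)"
  by (simp add: smooth_on_def cdiff_on_add)

lemma smooth_on_scaleR:
  "open S \<Longrightarrow> smooth_on S f \<Longrightarrow> smooth_on S h \<Longrightarrow> smooth_on S (\<lambda>x. f x *\<^sub>R h x)"
  by (simp add: smooth_on_def cdiff_on_scaleR)

lemma smooth_on_sum:
  "open S \<Longrightarrow> (\<And>i. i \<in> I \<Longrightarrow> smooth_on S (f i)) \<Longrightarrow> smooth_on S (\<lambda>x. \<Sum>i\<in>I. f i x)"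
  by (simp add: smooth_on_def cdiff_on_sum)

lemma smooth_on_id: "smooth_on S (\<lambda>x. x)"
proof -
  have "cdiff_on n UNIV (\<lambda>x::'a. x)" for n
    by (cases n)
      (auto intro!: cdiff_on_SucI[where f'="\<lambda>x v. v"] cdiff_on_const simp del: cdiff_on.simps(2))
  then show ?thesis by (auto simp: smooth_on_def intro: cdiff_on_subset)
qed

lemma smooth_on_compose:
  "open S \<Longrightarrow> smooth_on T F \<Longrightarrow> smooth_on S k \<Longrightarrow> k ` S \<subseteq> T \<Longrightarrow> smooth_on S (\<lambda>x. F (k x))"
  unfolding smooth_on_def by (metis cdiff_on_compose)

lemma smooth_on_inner_right: "smooth_on S (\<lambda>x. x \<bullet> b)"
proof -
  have "smooth_on UNIV (\<lambda>x. x \<bullet> b)"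
    using smooth_on_id[of "UNIV :: 'a set"] unfolding smooth_on_def
    by (auto intro: cdiff_on_linear[OF _ _ bounded_linear_inner_left])
  then show ?thesis by (rule smooth_on_subset) simp
qed

lemma smooth_on_inverse: "smooth_on (- {0}) (inverse :: real \<Rightarrow> real)"
  by (simp add: smooth_on_def cdiff_on_inverse)

text \<open>The bump is \<open>exp (-1/t)\<close> at \<open>t = \<epsilon>\<^sup>2 - \<bar>y - a\<bar>\<^sup>2\<close>.\<close>

lemma smooth_bump_on_ball:
  fixes a :: "'a::euclidean_space"
  assumes "\<epsilon> > 0"
  shows "\<exists>\<beta> :: 'a \<Rightarrow> real. smooth_on UNIV \<beta> \<and> \<beta> a \<noteq> 0 \<and> (\<forall>y. y \<notin> cball a \<epsilon> \<longrightarrow> \<beta> y = 0)"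
proof -
  let ?s = "\<lambda>y::'a. \<epsilon>\<^sup>2 - (norm (y - a))\<^sup>2"
  have "?s = (\<lambda>y. \<epsilon>\<^sup>2 + (\<Sum>b\<in>Basis. (-1) *\<^sub>R (((y + - a) \<bullet> b) *\<^sub>R ((y + - a) \<bullet> b))))"
    by (simp add: power2_norm_eq_inner euclidean_inner[of "_ - a" "_ - a"] sum_negf)
  moreover have "smooth_on UNIV (\<lambda>y::'a. (y + - a) \<bullet> b)" for b
    by (rule smooth_on_compose[OF _ smooth_on_inner_right[of UNIV]])
      (auto intro!: smooth_on_add smooth_on_id smooth_on_const simp del: add_uminus_conv_diff)
  ultimately have "smooth_on UNIV ?s"
    by (simp only: smooth_on_add smooth_on_sum smooth_on_scaleR smooth_on_const open_UNIV)
  then have "smooth_on UNIV (\<lambda>y. flat_exp 0 (?s y))"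
    by (rule smooth_on_compose[rotated 2, of UNIV _ UNIV "flat_exp 0"])
      (simp_all add: smooth_on_def cdiff_on_flat_exp)
  moreover have "flat_exp 0 (?s y) = 0" if "y \<notin> cball a \<epsilon>" for y
  proof -
    have "\<epsilon> \<le> norm (y - a)" using that by (simp add: dist_norm norm_minus_commute)
    then have "\<epsilon>\<^sup>2 \<le> (norm (y - a))\<^sup>2" using assms by (intro power_mono) auto
    then show ?thesis by (simp add: flat_exp_def)
  qed
  moreover have "flat_exp 0 (?s a) \<noteq> 0" using assms by (simp add: flat_exp_def)
  ultimately show ?thesis by blast
qed

section \<open>Smooth functions on manifolds\<close>

lemma
  assumes "smooth_atlas A" "c \<in> A"
  shows chart_open: "open (fst c)"
    and chart_homeomorphism: "homeomorphism (fst c) (snd c ` fst c) (snd c) (chart_inv c)"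
    and chart_range_open: "open (snd c ` fst c)"
  using assms unfolding smooth_atlas_def by auto

lemma transition_smooth:
  "smooth_atlas A \<Longrightarrow> c \<in> A \<Longrightarrow> d \<in> A \<Longrightarrow>
    smooth_on (snd c ` (fst c \<inter> fst d)) (\<lambda>z. snd d (chart_inv c z))"
  unfolding smooth_atlas_def comp_def by auto

lemma chart_inv_chart:
  "smooth_atlas A \<Longrightarrow> c \<in> A \<Longrightarrow> x \<in> fst c \<Longrightarrow> chart_inv c (snd c x) = x"
  by (metis chart_homeomorphism homeomorphism_apply1)

lemma chart_image_open:
  assumes "smooth_atlas A" "c \<in> A" "open S" "S \<subseteq> fst c"
  shows "open (snd c ` S)"
proof -
  have "openin (top_of_set (snd c ` fst c)) (snd c ` S)"
    using assms chart_homeomorphism[OF assms(1,2)]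
    by (intro homeomorphism_imp_open_map) (auto intro: open_subset)
  then show ?thesis
    using chart_range_open[OF assms(1,2)] openin_open_trans by blast
qed

lemma chart_at:
  assumes "smooth_atlas A"
  shows "chart_at A x \<in> A" "x \<in> fst (chart_at A x)"
proof -
  have "\<exists>c. c \<in> A \<and> x \<in> fst c" using assms unfolding smooth_atlas_def by blast
  then have "chart_at A x \<in> A \<and> x \<in> fst (chart_at A x)"
    unfolding chart_at_def by (rule someI_ex)
  then show "chart_at A x \<in> A" "x \<in> fst (chart_at A x)" by auto
qed

lemma msmooth_onD:
  "msmooth_on A S h \<Longrightarrow> c \<in> A \<Longrightarrow> smooth_on (snd c ` (S \<inter> fst c)) (\<lambda>z. h (chart_inv c z))"
  unfolding msmooth_on_def comp_def by auto

lemma msmooth_onI: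
  "(\<And>c. c \<in> A \<Longrightarrow> smooth_on (snd c ` (S \<inter> fst c)) (\<lambda>z. h (chart_inv c z))) \<Longrightarrow>
    msmooth_on A S h"
  unfolding msmooth_on_def comp_def by auto

lemma msmooth_on_subset: "msmooth_on A S h \<Longrightarrow> T \<subseteq> S \<Longrightarrow> msmooth_on A T h"
  unfolding msmooth_on_def by (meson Int_mono image_mono smooth_on_subset subset_refl)

lemma msmooth_on_cong:
  assumes "smooth_atlas A" "open S" "msmooth_on A S h" "\<And>x. x \<in> S \<Longrightarrow> h x = k x"
  shows "msmooth_on A S k"
proof (rule msmooth_onI)
  fix c assume c: "c \<in> A"
  show "smooth_on (snd c ` (S \<inter> fst c)) (\<lambda>z. k (chart_inv c z))"
    by (rule smooth_on_cong[OF chart_image_open[OF assms(1) c] msmooth_onD[OF assms(3) c]])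
      (use assms chart_open[OF assms(1) c] chart_inv_chart[OF assms(1) c] in auto)
qed

lemma msmooth_on_local:
  assumes "smooth_atlas A"
    and loc: "\<And>x. x \<in> S \<Longrightarrow> \<exists>U. open U \<and> x \<in> U \<and> msmooth_on A U h"
  shows "msmooth_on A S h"
proof (rule msmooth_onI, rule smooth_on_local)
  fix c z assume c: "c \<in> A" and "z \<in> snd c ` (S \<inter> fst c)"
  then obtain x where x: "x \<in> S" "x \<in> fst c" "z = snd c x" by auto
  obtain U where U: "open U" "x \<in> U" "msmooth_on A U h" using loc[OF x(1)] by auto
  then show "\<exists>V. open V \<and> z \<in> V \<and> smooth_on V (\<lambda>z. h (chart_inv c z))"
    using x c by (intro exI[of _ "snd c ` (U \<inter> fst c)"])
      (auto intro: msmooth_onD chart_image_open[OF assms(1) c] chart_open[OF assms(1) c])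
qed

lemma msmooth_on_const: "msmooth_on A S (\<lambda>x. k)"
  by (intro msmooth_onI smooth_on_const)

lemma msmooth_on_add:
  "smooth_atlas A \<Longrightarrow> open S \<Longrightarrow> msmooth_on A S h \<Longrightarrow> msmooth_on A S k \<Longrightarrow>
    msmooth_on A S (\<lambda>x. h x + k x)"
  by (rule msmooth_onI, rule smooth_on_add)
    (auto intro!: chart_image_open chart_open dest: msmooth_onD)

lemma msmooth_on_scaleR:
  "smooth_atlas A \<Longrightarrow> open S \<Longrightarrow> msmooth_on A S h \<Longrightarrow> msmooth_on A S k \<Longrightarrow>
    msmooth_on A S (\<lambda>x. h x *\<^sub>R k x)"
  by (rule msmooth_onI, rule smooth_on_scaleR)
    (auto intro!: chart_image_open chart_open dest: msmooth_onD)

text \<open>Composition with a smooth map of Euclidean spaces on the left. With \<open>k\<close> a coordinate map this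
also shows that smoothness in one chart implies smoothness in all charts.\<close>

lemma msmooth_on_compose:
  assumes "smooth_atlas A" "open S" "msmooth_on A S k" "smooth_on T F" "k ` S \<subseteq> T"
  shows "msmooth_on A S (\<lambda>x. F (k x))"
proof (rule msmooth_onI)
  fix c assume c: "c \<in> A"
  show "smooth_on (snd c ` (S \<inter> fst c)) (\<lambda>z. F (k (chart_inv c z)))"
    by (rule smooth_on_compose[OF _ assms(4) msmooth_onD[OF assms(3) c]])
      (use assms chart_open[OF assms(1) c] chart_inv_chart[OF assms(1) c] in
        \<open>auto intro!: chart_image_open[OF assms(1) c]\<close>)
qed

lemma msmooth_on_chart:
  assumes "smooth_atlas A" "c \<in> A" shows "msmooth_on A (fst c) (snd c)"
  using transition_smooth[OF assms(1) _ assms(2)] by (intro msmooth_onI) (simp add: Int_commute)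

lemma msmooth_imp_continuous:
  assumes "smooth_atlas A" "h \<in> smooth_functions A"
  shows "continuous_on UNIV h"
proof (intro continuous_at_imp_continuous_on ballI)
  fix x
  define c where "c = chart_at A x"
  have c: "c \<in> A" "x \<in> fst c" using chart_at[OF assms(1)] by (auto simp: c_def)
  have "smooth_on (snd c ` fst c) (\<lambda>z. h (chart_inv c z))"
    using msmooth_onD[of A UNIV h c] assms(2) c(1) by simp
  then have "continuous_on (snd c ` fst c) (\<lambda>z. h (chart_inv c z))"
    unfolding smooth_on_def using cdiff_on_imp_continuous_on by blast
  moreover have "continuous_on (fst c) (snd c)"
    using chart_homeomorphism[OF assms(1) c(1)] by (simp add: homeomorphism_def)
  ultimately have "continuous_on (fst c) (\<lambda>x. h (chart_inv c (snd c x)))"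
    by (rule continuous_on_compose2) simp
  then have "continuous_on (fst c) h"
    using chart_inv_chart[OF assms(1) c(1)] by (simp cong: continuous_on_cong)
  then show "isCont h x"
    using chart_open[OF assms(1) c(1)] c(2) by (simp add: continuous_on_eq_continuous_at)
qed

lemma smooth_map_ident: "smooth_atlas A \<Longrightarrow> smooth_map A A (\<lambda>x. x)"
  by (simp add: smooth_map_def comp_def msmooth_on_chart continuous_on_id)

lemma msmooth_on_pullback:
  assumes "smooth_atlas B" "smooth_atlas A" "smooth_map B A f" "msmooth_on A S h" "open S"
  shows "msmooth_on B (f -` S) (\<lambda>x. h (f x))"
proof (rule msmooth_on_local[OF assms(1)])
  fix x assume x: "x \<in> f -` S"
  define c where "c = chart_at A (f x)"
  have c: "c \<in> A" "f x \<in> fst c" using chart_at[OF assms(2)] by (auto simp: c_def)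
  let ?U = "f -` (S \<inter> fst c)"
  have U: "open ?U"
    using assms(3,5) chart_open[OF assms(2) c(1)] unfolding smooth_map_def
    by (intro open_vimage) auto
  have "msmooth_on B ?U (\<lambda>x. snd c (f x))"
    using assms(3) c(1) unfolding smooth_map_def comp_def by (auto intro: msmooth_on_subset)
  from msmooth_on_compose[OF assms(1) U this msmooth_onD[OF assms(4) c(1)]]
  have "msmooth_on B ?U (\<lambda>x. h (chart_inv c (snd c (f x))))" by auto
  then have "msmooth_on B ?U (\<lambda>x. h (f x))"
    by (rule msmooth_on_cong[OF assms(1) U]) (auto simp: chart_inv_chart[OF assms(2) c(1)])
  then show "\<exists>U. open U \<and> x \<in> U \<and> msmooth_on B U (\<lambda>x. h (f x))" using U x c by auto
qed

text \<open>The closed set \<open>K\<close>, which carries \<open>\<phi>\<close>, is a coordinate ball; it is closed because it is compact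
and the manifold is Hausdorff. Since \<open>V\<close> and the complement of \<open>K\<close> cover the manifold, \<open>\<phi>\<close>
turns objects that are smooth on \<open>V\<close> into globally smooth ones.\<close>

lemma smooth_bump_exists:
  assumes "smooth_atlas A" "open V" "x \<in> V"
  obtains \<phi> K where "\<phi> \<in> smooth_functions A" "closed K" "K \<subseteq> V" "\<phi> x \<noteq> 0"
    "\<And>y. y \<notin> K \<Longrightarrow> \<phi> y = (0::real)"
proof -
  define c where "c = chart_at A x"
  have c: "c \<in> A" "x \<in> fst c" using chart_at[OF assms(1)] by (auto simp: c_def)
  have o: "open (V \<inter> fst c)" using assms(2) chart_open[OF assms(1) c(1)] by auto
  have "open (snd c ` (V \<inter> fst c))" by (rule chart_image_open[OF assms(1) c(1) o]) simp
  then obtain \<epsilon> where \<epsilon>: "\<epsilon> > 0" "cball (snd c x) \<epsilon> \<subseteq> snd c ` (V \<inter> fst c)"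
    using c assms(3) by (metis IntI imageI open_contains_cball)
  obtain \<beta> :: "'b \<Rightarrow> real" where \<beta>: "smooth_on UNIV \<beta>" "\<beta> (snd c x) \<noteq> 0"
    "\<And>y. y \<notin> cball (snd c x) \<epsilon> \<Longrightarrow> \<beta> y = 0"
    using smooth_bump_on_ball[OF \<epsilon>(1)] by metis
  define K where "K = chart_inv c ` cball (snd c x) \<epsilon>"
  define \<phi> where "\<phi> y = (if y \<in> V \<inter> fst c then \<beta> (snd c y) else 0)" for y
  have "continuous_on (cball (snd c x) \<epsilon>) (chart_inv c)"
    using chart_homeomorphism[OF assms(1) c(1)] \<epsilon>(2)
    by (meson continuous_on_subset homeomorphism_def image_mono inf_le2 order_trans)
  then have K: "closed K"
    unfolding K_def by (intro compact_imp_closed compact_continuous_image) auto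
  have KV: "K \<subseteq> V \<inter> fst c"
    using \<epsilon>(2) chart_inv_chart[OF assms(1) c(1)] unfolding K_def by force
  have \<phi>0: "\<phi> y = 0" if "y \<notin> K" for y
  proof (cases "y \<in> V \<inter> fst c")
    case True
    then have "snd c y \<notin> cball (snd c x) \<epsilon>"
      using that chart_inv_chart[OF assms(1) c(1), of y] unfolding K_def by force
    then show ?thesis by (simp add: \<phi>_def \<beta>(3))
  qed (simp only: \<phi>_def if_False)
  have "msmooth_on A (V \<inter> fst c) \<phi>"
    by (rule msmooth_on_cong[OF assms(1) o msmooth_on_compose
          [OF assms(1) o msmooth_on_subset[OF msmooth_on_chart[OF assms(1) c(1)]] \<beta>(1)]])
      (auto simp: \<phi>_def)
  moreover have "msmooth_on A (- K) \<phi>"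
    by (rule msmooth_on_cong[OF assms(1) _ msmooth_on_const[of _ _ 0]]) (use K \<phi>0 in auto)
  ultimately have "msmooth_on A UNIV \<phi>"
    using o K KV by (intro msmooth_on_local[OF assms(1)]) (metis ComplI open_Compl subsetD)
  then show thesis
    using that[of \<phi> K] K KV \<phi>0 c assms(3) \<beta>(2) by (auto simp: \<phi>_def)
qed

section \<open>Sections of pulled back tangent bundles\<close>

text \<open>The derivative at \<open>y\<close> of the change of coordinates from the chart \<open>c\<close> to the chart \<open>d\<close>: it
converts the \<open>c\<close>-coordinates of a tangent vector at \<open>y\<close> into its \<open>d\<close>-coordinates.\<close>

definition transition_deriv ::
    "('m, 'e::euclidean_space) chart \<Rightarrow> ('m, 'e) chart \<Rightarrow> 'm \<Rightarrow> 'e \<Rightarrow> 'e" where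
  "transition_deriv c d y = frechet_derivative (\<lambda>z. snd d (chart_inv c z)) (at (snd c y))"

lemma mderiv_chart: "mderiv A (snd d) y = transition_deriv (chart_at A y) d y"
  by (simp add: mderiv_def transition_deriv_def comp_def fun_eq_iff)

lemma transition_has_derivative:
  assumes "smooth_atlas A" "c \<in> A" "d \<in> A" "y \<in> fst c" "y \<in> fst d"
  shows "((\<lambda>z. snd d (chart_inv c z)) has_derivative transition_deriv c d y) (at (snd c y))"
  unfolding transition_deriv_def
  by (rule smooth_on_imp_has_derivative[OF transition_smooth[OF assms(1-3)]]) (use assms in auto)

lemma linear_transition_deriv:
  assumes "smooth_atlas A" "c \<in> A" "d \<in> A" "y \<in> fst c" "y \<in> fst d"
  shows "linear (transition_deriv c d y)"
  using transition_has_derivative[OF assms] has_derivative_linear by blast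

lemma transition_deriv_cocycle:
  assumes "smooth_atlas A" "c \<in> A" "d \<in> A" "e \<in> A" "y \<in> fst c" "y \<in> fst d" "y \<in> fst e"
  shows "transition_deriv d e y (transition_deriv c d y v) = transition_deriv c e y v"
proof -
  have "((\<lambda>z. snd e (chart_inv d (snd d (chart_inv c z)))) has_derivative
      (\<lambda>v. transition_deriv d e y (transition_deriv c d y v))) (at (snd c y))"
    using assms transition_has_derivative[of A d e y]
    by (intro has_derivative_compose[OF transition_has_derivative[of A c d y]])
      (simp_all add: chart_inv_chart)
  then have "((\<lambda>z. snd e (chart_inv c z)) has_derivative
      (\<lambda>v. transition_deriv d e y (transition_deriv c d y v))) (at (snd c y))"
    by (rule has_derivative_transform_within_open[where s="snd c ` (fst c \<inter> fst d)"])
      (use assms in \<open>auto simp: chart_inv_chart[OF assms(1)] chart_open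
         intro!: chart_image_open[OF assms(1,2)]\<close>)
  then show ?thesis
    using transition_has_derivative[of A c e y] assms has_derivative_unique by metis
qed

lemma transition_deriv_self:
  assumes "smooth_atlas A" "c \<in> A" "y \<in> fst c"
  shows "transition_deriv c c y v = v"
proof -
  have "((\<lambda>z. snd c (chart_inv c z)) has_derivative (\<lambda>v. v)) (at (snd c y))"
    by (rule has_derivative_transform_within_open[OF has_derivative_ident, where s="snd c ` fst c"])
      (use assms in \<open>auto simp: chart_inv_chart[OF assms(1)] chart_range_open[OF assms(1)]\<close>)
  then show ?thesis
    using transition_has_derivative[of A c c y] assms has_derivative_unique by metis
qed

lemma linear_mderiv_chart:
  assumes "smooth_atlas A" "c \<in> A" "y \<in> fst c"
  shows "linear (mderiv A (snd c) y)"
  unfolding mderiv_chart using assms chart_at by (intro linear_transition_deriv) auto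

lemma smooth_map_vimage_open: "smooth_map B A f \<Longrightarrow> open S \<Longrightarrow> open (f -` S)"
  unfolding smooth_map_def by (auto intro: open_vimage)

lemma section_onD:
  "section_on B A f V X \<Longrightarrow> c \<in> A \<Longrightarrow>
    msmooth_on B (V \<inter> f -` fst c) (\<lambda>x. mderiv A (snd c) (f x) (X x))"
  unfolding section_on_def by auto

lemma section_on_subset: "section_on B A f V X \<Longrightarrow> T \<subseteq> V \<Longrightarrow> section_on B A f T X"
  unfolding section_on_def by (meson Int_mono msmooth_on_subset subset_refl)

lemma section_on_zero:
  assumes "smooth_atlas B" "smooth_atlas A" "smooth_map B A f" "open V"
  shows "section_on B A f V (\<lambda>x. 0)"
  unfolding section_on_def
proof
  fix c assume c: "c \<in> A"
  show "msmooth_on B (V \<inter> f -` fst c) (\<lambda>x. mderiv A (snd c) (f x) 0)"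
    by (rule msmooth_on_cong[OF assms(1) _ msmooth_on_const[of _ _ 0]])
      (use assms smooth_map_vimage_open[OF assms(3) chart_open[OF assms(2) c]]
        linear_0[OF linear_mderiv_chart[OF assms(2) c]] in auto)
qed

lemma section_on_cong:
  assumes "smooth_atlas B" "smooth_atlas A" "smooth_map B A f" "open V"
    "section_on B A f V X" "\<And>x. x \<in> V \<Longrightarrow> X x = Y x"
  shows "section_on B A f V Y"
  unfolding section_on_def
proof
  fix c assume c: "c \<in> A"
  show "msmooth_on B (V \<inter> f -` fst c) (\<lambda>x. mderiv A (snd c) (f x) (Y x))"
    by (rule msmooth_on_cong[OF assms(1) _ section_onD[OF assms(5) c]])
      (use assms smooth_map_vimage_open[OF assms(3) chart_open[OF assms(2) c]] in auto)
qed

lemma section_on_local: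
  assumes "smooth_atlas B"
    and loc: "\<And>x. x \<in> V \<Longrightarrow> \<exists>U. open U \<and> x \<in> U \<and> section_on B A f U X"
    and "smooth_atlas A" "smooth_map B A f"
  shows "section_on B A f V X"
  unfolding section_on_def
proof (intro ballI msmooth_on_local[OF assms(1)])
  fix c x assume c: "c \<in> A" and x: "x \<in> V \<inter> f -` fst c"
  then obtain U where U: "open U" "x \<in> U" "section_on B A f U X" using loc by auto
  then show "\<exists>U. open U \<and> x \<in> U \<and> msmooth_on B U (\<lambda>x. mderiv A (snd c) (f x) (X x))"
    using x smooth_map_vimage_open[OF assms(4) chart_open[OF assms(3) c]] section_onD[OF U(3) c]
    by (intro exI[of _ "U \<inter> f -` fst c"]) auto
qed

lemma section_on_add:
  assumes "smooth_atlas B" "smooth_atlas A" "smooth_map B A f" "open V"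
    "section_on B A f V X" "section_on B A f V Y"
  shows "section_on B A f V (\<lambda>x. X x + Y x)"
  unfolding section_on_def
proof
  fix c assume c: "c \<in> A"
  have o: "open (V \<inter> f -` fst c)"
    using assms(4) smooth_map_vimage_open[OF assms(3) chart_open[OF assms(2) c]] by auto
  show "msmooth_on B (V \<inter> f -` fst c) (\<lambda>x. mderiv A (snd c) (f x) (X x + Y x))"
    by (rule msmooth_on_cong[OF assms(1) o msmooth_on_add[OF assms(1) o
            section_onD[OF assms(5) c] section_onD[OF assms(6) c]]])
      (simp add: linear_add[OF linear_mderiv_chart[OF assms(2) c]])
qed

lemma section_on_scaleR:
  assumes "smooth_atlas B" "smooth_atlas A" "smooth_map B A f" "open V"
    "msmooth_on B V h" "section_on B A f V X"
  shows "section_on B A f V (\<lambda>x. h x *\<^sub>R X x)"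
  unfolding section_on_def
proof
  fix c assume c: "c \<in> A"
  have o: "open (V \<inter> f -` fst c)"
    using assms(4) smooth_map_vimage_open[OF assms(3) chart_open[OF assms(2) c]] by auto
  show "msmooth_on B (V \<inter> f -` fst c) (\<lambda>x. mderiv A (snd c) (f x) (h x *\<^sub>R X x))"
    by (rule msmooth_on_cong[OF assms(1) o msmooth_on_scaleR[OF assms(1) o
            msmooth_on_subset[OF assms(5)] section_onD[OF assms(6) c]]])
      (simp_all add: linear_scale[OF linear_mderiv_chart[OF assms(2) c]])
qed

lemma section_on_sum:
  assumes "smooth_atlas B" "smooth_atlas A" "smooth_map B A f" "open V"
    "\<And>i. i \<in> I \<Longrightarrow> section_on B A f V (X i)"
  shows "section_on B A f V (\<lambda>x. \<Sum>i\<in>I. X i x)"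
  using assms(5)
  by (induction I rule: infinite_finite_induct)
    (auto intro: section_on_zero[OF assms(1-4)] section_on_add[OF assms(1-4)])

lemma section_on_extend_by_zero:
  assumes "smooth_atlas B" "smooth_atlas A" "smooth_map B A f" "open V" "section_on B A f V X"
    "closed K" "K \<subseteq> V" "\<phi> \<in> smooth_functions B" "\<And>x. x \<notin> K \<Longrightarrow> \<phi> x = (0::real)"
  shows "section_on B A f UNIV (\<lambda>x. if x \<in> V then \<phi> x *\<^sub>R X x else 0)"
    (is "section_on B A f UNIV ?Y")
proof (rule section_on_local[OF assms(1) _ assms(2,3)])
  fix x
  have "msmooth_on B V \<phi>" using assms(8) msmooth_on_subset[of B UNIV \<phi> V] by simp
  then have 1: "section_on B A f V ?Y"
    by (rule section_on_cong[OF assms(1-4) section_on_scaleR[OF assms(1-4) _ assms(5)]]) auto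
  have K: "open (- K)" using assms(6) by auto
  have 2: "section_on B A f (- K) ?Y"
    by (rule section_on_cong[OF assms(1-3) K section_on_zero[OF assms(1-3) K]])
      (use assms(9) in auto)
  show "\<exists>U. open U \<and> x \<in> U \<and> section_on B A f U ?Y"
    using 1 2 assms(4,6,7) by (metis ComplI open_Compl subsetD)
qed

lemma vector_field_pullback:
  assumes "smooth_atlas B" "smooth_atlas A" "smooth_map B A f" "X \<in> vector_fields A"
  shows "section_on B A f UNIV (\<lambda>x. X (f x))"
  unfolding section_on_def
proof
  fix c assume c: "c \<in> A"
  have "msmooth_on A (fst c) (\<lambda>y. mderiv A (snd c) y (X y))"
    using assms(4) section_onD[OF _ c, of A "\<lambda>x. x" UNIV X] by simp
  from msmooth_on_pullback[OF assms(1-3) this chart_open[OF assms(2) c]]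
  show "msmooth_on B (UNIV \<inter> f -` fst c) (\<lambda>x. mderiv A (snd c) (f x) (X (f x)))" by simp
qed

text \<open>The vector field on the domain of \<open>c\<close> whose coordinates in \<open>c\<close> are constantly \<open>v\<close>;
values off that domain are irrelevant. Tangent vectors
at \<open>y\<close> being stored in the preferred chart at \<open>y\<close>, the value is converted to that chart.\<close>

definition coordinate_field ::
    "('m, 'e::euclidean_space) chart set \<Rightarrow> ('m, 'e) chart \<Rightarrow> 'e \<Rightarrow> 'm \<Rightarrow> 'e" where
  "coordinate_field A c v y = transition_deriv c (chart_at A y) y v"

lemma coordinate_field_section:
  assumes "smooth_atlas A" "c \<in> A"
  shows "section_on A A (\<lambda>x. x) (fst c) (coordinate_field A c v)"
  unfolding section_on_def
proof
  fix d assume d: "d \<in> A"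
  have o: "open (fst c \<inter> fst d)" by (intro open_Int chart_open[OF assms(1)] assms(2) d)
  have "msmooth_on A (fst c \<inter> fst d) (\<lambda>y. transition_deriv c d y v)"
    unfolding transition_deriv_def
    by (rule msmooth_on_compose[OF assms(1) o msmooth_on_subset[OF msmooth_on_chart[OF assms]]
          smooth_on_frechet_derivative[OF transition_smooth[OF assms d]]]) auto
  then have "msmooth_on A (fst c \<inter> fst d) (\<lambda>y. mderiv A (snd d) y (coordinate_field A c v y))"
    by (rule msmooth_on_cong[OF assms(1) o])
      (simp add: mderiv_chart coordinate_field_def transition_deriv_cocycle[OF assms(1)]
        chart_at[OF assms(1)] assms(2) d)
  then show "msmooth_on A (fst c \<inter> (\<lambda>x. x) -` fst d)
      (\<lambda>y. mderiv A (snd d) y (coordinate_field A c v y))" by simp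
qed

lemma coordinate_field_expansion:
  assumes "smooth_atlas A" "c \<in> A" "y \<in> fst c"
  shows "coordinate_field A c (mderiv A (snd c) y v) y = v"
    and "coordinate_field A c w y = (\<Sum>b\<in>Basis. (w \<bullet> b) *\<^sub>R coordinate_field A c b y)"
proof -
  show "coordinate_field A c (mderiv A (snd c) y v) y = v"
    using assms chart_at[OF assms(1)]
    by (simp add: coordinate_field_def mderiv_chart transition_deriv_cocycle[OF assms(1)]
        transition_deriv_self[OF assms(1)])
  interpret linear "transition_deriv c (chart_at A y) y"
    using assms chart_at[OF assms(1)] by (intro linear_transition_deriv)
  have "transition_deriv c (chart_at A y) y (\<Sum>b\<in>Basis. (w \<bullet> b) *\<^sub>R b)
      = (\<Sum>b\<in>Basis. (w \<bullet> b) *\<^sub>R transition_deriv c (chart_at A y) y b)"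
    by (simp only: sum scale)
  then show "coordinate_field A c w y = (\<Sum>b\<in>Basis. (w \<bullet> b) *\<^sub>R coordinate_field A c b y)"
    by (simp only: coordinate_field_def euclidean_representation)
qed

lemma vector_field_through:
  assumes "smooth_atlas A"
  shows "\<exists>X\<in>vector_fields A. X y = v"
proof -
  define c where "c = chart_at A y"
  have c: "c \<in> A" "y \<in> fst c" using chart_at[OF assms] by (auto simp: c_def)
  note sa = assms assms smooth_map_ident[OF assms] chart_open[OF assms c(1)]
  obtain \<phi> K where \<phi>: "\<phi> \<in> smooth_functions A" "closed K" "K \<subseteq> fst c" "\<phi> y \<noteq> 0"
    "\<And>x. x \<notin> K \<Longrightarrow> \<phi> x = (0::real)"
    by (rule smooth_bump_exists[OF assms chart_open[OF assms c(1)] c(2)]) (rule that)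
  define w where "w = mderiv A (snd c) y v"
  let ?X = "\<lambda>x. if x \<in> fst c then \<phi> x *\<^sub>R coordinate_field A c w x else 0"
  have X: "section_on A A (\<lambda>x. x) UNIV ?X"
    by (rule section_on_extend_by_zero[OF sa coordinate_field_section[OF assms c(1)] \<phi>(2,3,1,5)])
  have "section_on A A (\<lambda>x. x) UNIV (\<lambda>x. inverse (\<phi> y) *\<^sub>R ?X x)"
    by (rule section_on_scaleR[OF sa(1-3) open_UNIV msmooth_on_const X])
  moreover have "inverse (\<phi> y) *\<^sub>R ?X y = v"
    using c \<phi>(4) coordinate_field_expansion(1)[OF assms c] by (simp add: w_def)
  ultimately show ?thesis
    by (intro bexI[of _ "\<lambda>x. inverse (\<phi> y) *\<^sub>R ?X x"]) simp_all
qed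

text \<open>Near a given point, a section along \<open>f\<close> is a combination of restrictions \<open>E b \<circ> f\<close> of vector
fields of the ambient manifold, with smooth coefficients. Multiplication by \<open>h\<close>, which
does not vanish at \<open>x\<close>, makes this a global identity, so that it can be used with operators that
are only defined on global sections.\<close>

lemma section_expansion:
  fixes A :: "('m::{t2_space, second_countable_topology}, 'e::euclidean_space) chart set"
  assumes "smooth_atlas B" "smooth_atlas A" "smooth_map B A f" "section_on B A f UNIV U"
  obtains h u E where "h \<in> smooth_functions B" "h x \<noteq> 0"
    "\<And>b. b \<in> Basis \<Longrightarrow> u b \<in> smooth_functions B"
    "\<And>b. b \<in> Basis \<Longrightarrow> E b \<in> vector_fields A"
    "\<And>y. h y *\<^sub>R U y = (\<Sum>b\<in>(Basis :: 'e set). u b y *\<^sub>R E b (f y))"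
proof -
  define c where "c = chart_at A (f x)"
  have c: "c \<in> A" "f x \<in> fst c" using chart_at[OF assms(2)] by (auto simp: c_def)
  obtain \<phi> K where \<phi>: "\<phi> \<in> smooth_functions A" "closed K" "K \<subseteq> fst c" "\<phi> (f x) \<noteq> 0"
    "\<And>y. y \<notin> K \<Longrightarrow> \<phi> y = (0::real)"
    by (rule smooth_bump_exists[OF assms(2) chart_open[OF assms(2) c(1)] c(2)]) (rule that)
  \<comment> \<open>Both the frame and the coefficients are cut off by \<open>\<phi>\<close>, which accounts for \<open>h = (\<phi> \<circ> f)\<^sup>2\<close>.\<close>
  define E where "E b y = (if y \<in> fst c then \<phi> y *\<^sub>R coordinate_field A c b y else 0)" for b y
  define w where "w = (\<lambda>y. mderiv A (snd c) (f y) (U y))"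
  define u where "u b y = (if f y \<in> fst c then \<phi> (f y) *\<^sub>R (w y \<bullet> b) else 0)" for b y
  have E: "E b \<in> vector_fields A" for b
    unfolding E_def
    using section_on_extend_by_zero[OF assms(2,2) smooth_map_ident[OF assms(2)]
        chart_open[OF assms(2) c(1)] coordinate_field_section[OF assms(2) c(1)] \<phi>(2,3,1,5)]
    by simp
  have \<phi>f: "msmooth_on B UNIV (\<lambda>y. \<phi> (f y))"
    using msmooth_on_pullback[OF assms(1-3), of UNIV \<phi>] \<phi>(1) by simp
  have "u b \<in> smooth_functions B" for b
  proof -
    have o: "open (f -` fst c)" "open (f -` (- K))"
      using smooth_map_vimage_open[OF assms(3)] chart_open[OF assms(2) c(1)] \<phi>(2) by blast+
    have "msmooth_on B (f -` fst c) w"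
      using section_onD[OF assms(4) c(1)] by (simp add: w_def)
    from msmooth_on_compose[OF assms(1) o(1) this smooth_on_inner_right[of UNIV]]
    have "msmooth_on B (f -` fst c) (\<lambda>y. w y \<bullet> b)" by simp
    from msmooth_on_scaleR[OF assms(1) o(1) msmooth_on_subset[OF \<phi>f subset_UNIV] this]
    have "msmooth_on B (f -` fst c) (u b)"
      by (rule msmooth_on_cong[OF assms(1) o(1)]) (auto simp: u_def)
    moreover have "msmooth_on B (f -` (- K)) (u b)"
      by (rule msmooth_on_cong[OF assms(1) o(2) msmooth_on_const[of _ _ 0]])
        (use \<phi>(5) in \<open>auto simp: u_def\<close>)
    ultimately have "msmooth_on B UNIV (u b)"
      using o \<phi>(3) by (intro msmooth_on_local[OF assms(1)]) (metis ComplI subsetD vimageI)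
    then show ?thesis by simp
  qed
  moreover have "(\<phi> (f y) *\<^sub>R \<phi> (f y)) *\<^sub>R U y = (\<Sum>b\<in>Basis. u b y *\<^sub>R E b (f y))" for y
  proof (cases "f y \<in> fst c")
    case True
    have "U y = (\<Sum>b\<in>Basis. (w y \<bullet> b) *\<^sub>R coordinate_field A c b (f y))"
      using coordinate_field_expansion[OF assms(2) c(1) True] unfolding w_def by metis
    then have "(\<phi> (f y) *\<^sub>R \<phi> (f y)) *\<^sub>R U y =
        (\<phi> (f y) *\<^sub>R \<phi> (f y)) *\<^sub>R (\<Sum>b\<in>Basis. (w y \<bullet> b) *\<^sub>R coordinate_field A c b (f y))"
      by (simp only:)
    then show ?thesis
      using True by (simp add: u_def E_def scaleR_sum_right mult_ac)
  next
    case False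
    then have "f y \<notin> K" using \<phi>(3) by auto
    then show ?thesis using False by (simp add: u_def \<phi>(5))
  qed
  moreover have "(\<lambda>y. \<phi> (f y) *\<^sub>R \<phi> (f y)) \<in> smooth_functions B"
    using msmooth_on_scaleR[OF assms(1) open_UNIV \<phi>f \<phi>f] by simp
  ultimately show thesis
    using that[of "\<lambda>y. \<phi> (f y) *\<^sub>R \<phi> (f y)" u E] E \<phi>(4) by simp
qed

section \<open>Tensor fields and the induced connection\<close>

text \<open>A \<open>(1,1)\<close>-tensor field, assumed to preserve smoothness of ambient vector fields only, also
preserves smoothness of sections along \<open>f\<close>.\<close>

lemma tensor_section:
  fixes A :: "('m::{t2_space, second_countable_topology}, 'e::euclidean_space) chart set"
  assumes "smooth_atlas B" "smooth_atlas A" "smooth_map B A f"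
    and lin: "\<And>y. linear (J y)"
    and smooth: "\<And>X. X \<in> vector_fields A \<Longrightarrow> (\<lambda>y. J y (X y)) \<in> vector_fields A"
    and U: "section_on B A f UNIV U"
  shows "section_on B A f UNIV (\<lambda>x. J (f x) (U x))"
proof (rule section_on_local[OF assms(1) _ assms(2,3)])
  fix x
  obtain h u E where h: "h \<in> smooth_functions B" "h x \<noteq> 0"
    and u: "\<And>b. b \<in> Basis \<Longrightarrow> u b \<in> smooth_functions B"
    and E: "\<And>b. b \<in> Basis \<Longrightarrow> E b \<in> vector_fields A"
    and hU: "\<And>y. h y *\<^sub>R U y = (\<Sum>b\<in>(Basis :: 'e set). u b y *\<^sub>R E b (f y))"
    by (rule section_expansion[OF assms(1-3) U, of x]) (rule that)
  let ?O = "h -` (- {0})"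
  have O: "open ?O"
    by (rule open_vimage[OF _ msmooth_imp_continuous[OF assms(1) h(1)]]) auto
  \<comment> \<open>Where \<open>h \<noteq> 0\<close>, the expansion of \<open>h U\<close> gives one of \<open>J U\<close> after division by \<open>h\<close>.\<close>
  have inv: "msmooth_on B ?O (\<lambda>y. inverse (h y))"
    by (rule msmooth_on_compose[OF assms(1) O _ smooth_on_inverse])
      (use h(1) in \<open>auto intro: msmooth_on_subset\<close>)
  have "section_on B A f UNIV (\<lambda>y. \<Sum>b\<in>Basis. u b y *\<^sub>R J (f y) (E b (f y)))"
    by (intro section_on_sum section_on_scaleR assms(1-3) open_UNIV
        vector_field_pullback[OF assms(1-3) smooth]) (use u E in auto)
  then have "section_on B A f ?O (\<lambda>y. \<Sum>b\<in>Basis. u b y *\<^sub>R J (f y) (E b (f y)))"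
    by (rule section_on_subset) simp
  from section_on_scaleR[OF assms(1-3) O inv this]
  have "section_on B A f ?O (\<lambda>x. J (f x) (U x))"
  proof (rule section_on_cong[OF assms(1-3) O])
    fix y assume "y \<in> ?O"
    have JhU: "J (f y) (h y *\<^sub>R U y) = (\<Sum>b\<in>Basis. u b y *\<^sub>R J (f y) (E b (f y)))"
      unfolding hU by (simp add: linear_sum[OF lin] linear_scale[OF lin])
    then show "inverse (h y) *\<^sub>R (\<Sum>b\<in>Basis. u b y *\<^sub>R J (f y) (E b (f y))) = J (f y) (U y)"
      using \<open>y \<in> ?O\<close> by (simp add: linear_scale[OF lin] flip: JhU)
  qed
  then show "\<exists>V. open V \<and> x \<in> V \<and> section_on B A f V (\<lambda>x. J (f x) (U x))"
    using O h(2) by (intro exI[of _ ?O]) auto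
qed

lemma
  assumes "induced_connection B A f D Df" "W \<in> sections B A f (tangent_bundle B A f)"
  shows induced_connection_add:
      "section_on B A f UNIV U \<Longrightarrow> section_on B A f UNIV U' \<Longrightarrow>
        Df W (\<lambda>y. U y + U' y) x = Df W U x + Df W U' x"
    and induced_connection_leibniz:
      "h \<in> smooth_functions B \<Longrightarrow> section_on B A f UNIV U \<Longrightarrow>
        Df W (\<lambda>y. h y *\<^sub>R U y) x =
          mderiv B h x (inv (differential B A f x) (W x)) *\<^sub>R U x + h x *\<^sub>R Df W U x"
    and induced_connection_extends:
      "X \<in> vector_fields A \<Longrightarrow> Y \<in> vector_fields A \<Longrightarrow> X (f x) = W x \<Longrightarrow>
        Df W (\<lambda>y. Y (f y)) x = D X Y (f x)"
  using assms unfolding induced_connection_def Let_def sections_def by simp_all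

lemma induced_connection_sum:
  assumes "smooth_atlas B" "smooth_atlas A" "smooth_map B A f"
    and con: "induced_connection B A f D Df" "W \<in> sections B A f (tangent_bundle B A f)"
    and "finite I"
    and "\<And>i. i \<in> I \<Longrightarrow> u i \<in> smooth_functions B" "\<And>i. i \<in> I \<Longrightarrow> section_on B A f UNIV (Y i)"
  shows "Df W (\<lambda>y. \<Sum>i\<in>I. u i y *\<^sub>R Y i y) x =
    (\<Sum>i\<in>I. mderiv B (u i) x (inv (differential B A f x) (W x)) *\<^sub>R Y i x + u i x *\<^sub>R Df W (Y i) x)"
  using assms(6-)
proof (induction I rule: finite_induct)
  case empty
  have "section_on B A f UNIV (\<lambda>x. 0)" by (rule section_on_zero[OF assms(1-3)]) simp
  \<comment> \<open>Additivity at \<open>0 + 0 = 0\<close>.\<close>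
  from induced_connection_add[OF con this this, of x] show ?case by simp
next
  case (insert i I)
  have s: "section_on B A f UNIV (\<lambda>y. u i y *\<^sub>R Y i y)"
    using insert.prems by (intro section_on_scaleR[OF assms(1-3)]) auto
  have "section_on B A f UNIV (\<lambda>y. \<Sum>i\<in>I. u i y *\<^sub>R Y i y)"
    using insert.prems by (intro section_on_sum section_on_scaleR assms(1-3)) auto
  from induced_connection_add[OF con s this, of x] show ?case
    using insert by (simp add: induced_connection_leibniz[OF con])
qed

text \<open>If \<open>J\<close> is parallel for \<open>D\<close>, it is parallel for the induced connection. This is immediate for restrictions
of ambient fields, and \<open>section_expansion\<close> reduces the general case to these: the terms
that contain derivatives of coefficients agree on both sides because \<open>J\<close> is linear.\<close>

lemma induced_connection_parallel:
  fixes A :: "('m::{t2_space, second_countable_topology}, 'e::euclidean_space) chart set"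
  assumes sm: "smooth_atlas B" "smooth_atlas A" "smooth_map B A f"
    and con: "induced_connection B A f D Df" "W \<in> sections B A f (tangent_bundle B A f)"
    and lin: "\<And>y. linear (J y)"
    and smooth: "\<And>X. X \<in> vector_fields A \<Longrightarrow> (\<lambda>y. J y (X y)) \<in> vector_fields A"
    and par: "\<And>X Y y. X \<in> vector_fields A \<Longrightarrow> Y \<in> vector_fields A \<Longrightarrow>
      D X (\<lambda>y. J y (Y y)) y = J y (D X Y y)"
    and U: "section_on B A f UNIV U"
  shows "Df W (\<lambda>x. J (f x) (U x)) x = J (f x) (Df W U x)"
proof -
  obtain h u E where h: "h \<in> smooth_functions B" "h x \<noteq> 0"
    and u: "\<And>b. b \<in> Basis \<Longrightarrow> u b \<in> smooth_functions B"
    and E: "\<And>b. b \<in> Basis \<Longrightarrow> E b \<in> vector_fields A"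
    and hU: "\<And>y. h y *\<^sub>R U y = (\<Sum>b\<in>(Basis :: 'e set). u b y *\<^sub>R E b (f y))"
    by (rule section_expansion[OF sm U, of x]) (rule that)
  obtain X where X: "X \<in> vector_fields A" "X (f x) = W x"
    using vector_field_through[OF sm(2)] by metis
  let ?dW = "\<lambda>k. mderiv B k x (inv (differential B A f x) (W x))"
  note linJ = linear_add[OF lin] linear_scale[OF lin] linear_sum[OF lin]
  have JU: "section_on B A f UNIV (\<lambda>x. J (f x) (U x))"
    by (rule tensor_section[OF sm lin smooth U])
  have "Df W (\<lambda>y. h y *\<^sub>R J (f y) (U y)) x =
      Df W (\<lambda>y. \<Sum>b\<in>Basis. u b y *\<^sub>R J (f y) (E b (f y))) x"
    unfolding linJ(2)[symmetric] hU by (simp add: linJ)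
  also have "\<dots> = (\<Sum>b\<in>Basis. ?dW (u b) *\<^sub>R J (f x) (E b (f x))
      + u b x *\<^sub>R Df W (\<lambda>y. J (f y) (E b (f y))) x)"
    using u by (intro induced_connection_sum[OF sm con] finite_Basis
        vector_field_pullback[OF sm smooth[OF E]])
  also have "\<dots> = J (f x) (\<Sum>b\<in>Basis. ?dW (u b) *\<^sub>R E b (f x) + u b x *\<^sub>R Df W (\<lambda>y. E b (f y)) x)"
    unfolding linJ
    by (intro sum.cong refl) (simp add: induced_connection_extends[OF con X(1) E X(2)]
        induced_connection_extends[OF con X(1) smooth[OF E] X(2)] par[OF X(1) E])
  also have "\<dots> = J (f x) (Df W (\<lambda>y. h y *\<^sub>R U y) x)"
    unfolding hU using u
    by (intro arg_cong[where f="J (f x)"] induced_connection_sum[OF sm con, symmetric] finite_Basis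
        vector_field_pullback[OF sm E])
  finally have "h x *\<^sub>R Df W (\<lambda>x. J (f x) (U x)) x = h x *\<^sub>R J (f x) (Df W U x)"
    unfolding induced_connection_leibniz[OF con h(1) U] induced_connection_leibniz[OF con h(1) JU]
    by (simp add: linJ)
  then show ?thesis using h(2) by simp
qed

text \<open>The values at \<open>x\<close> of the global sections of a subbundle span its fibre: the members of a local
frame become global sections when multiplied by a bump function.\<close>

lemma linear_vanishes_if_on_sections:
  assumes sm: "smooth_atlas B" "smooth_atlas A" "smooth_map B A f"
    and "subbundle B A f S k" "\<And>x. 0 \<in> S x" "linear b"
    and orth: "\<And>Z. Z \<in> sections B A f S \<Longrightarrow> b (Z x) = (0::real)"
    and "z \<in> S x"
  shows "b z = 0"
proof -
  obtain V e where xV: "x \<in> V" and fr: "local_frame B A f S k V e"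
    using assms(4) unfolding subbundle_def by blast
  have V: "open V" and e: "\<And>i. i < k \<Longrightarrow> section_on B A f V (e i)"
    and span: "\<And>y. y \<in> V \<Longrightarrow> span ((\<lambda>i. e i y) ` {..<k}) = S y"
    using fr unfolding local_frame_def by auto
  obtain \<phi> K where \<phi>: "\<phi> \<in> smooth_functions B" "closed K" "K \<subseteq> V" "\<phi> x \<noteq> 0"
    "\<And>y. y \<notin> K \<Longrightarrow> \<phi> y = (0::real)"
    by (rule smooth_bump_exists[OF sm(1) V xV]) (rule that)
  have be: "b (e i x) = 0" if i: "i < k" for i
  proof -
    have "\<phi> y *\<^sub>R e i y \<in> S y" if "y \<in> V" for y
      unfolding span[OF that, symmetric] using i by (intro span_scale span_base imageI) simp
    then have "(\<lambda>y. if y \<in> V then \<phi> y *\<^sub>R e i y else 0) \<in> sections B A f S"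
      using section_on_extend_by_zero[OF sm V e[OF i] \<phi>(2,3,1,5)] assms(5)
      by (auto simp: sections_def)
    from orth[OF this] show ?thesis using xV \<phi>(4) by (simp add: linear_scale[OF assms(6)])
  qed
  have "b z = 0" if "z \<in> span ((\<lambda>i. e i x) ` {..<k})"
    by (rule linear_eq_0_on_span[OF assms(6) _ that]) (use be in auto)
  then show ?thesis using assms(8) span[OF xV] by simp
qed

section \<open>The radical distribution\<close>

theorem theorem3p11:
  fixes p q r :: nat
    and A :: "('m::{t2_space, second_countable_topology}, 'e::euclidean_space) chart set"
    and g :: "'m \<Rightarrow> 'e \<Rightarrow> 'e \<Rightarrow> real"
    and J :: "'m \<Rightarrow> 'e \<Rightarrow> 'e"
    and D :: "('m \<Rightarrow> 'e) \<Rightarrow> ('m \<Rightarrow> 'e) \<Rightarrow> 'm \<Rightarrow> 'e"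
    and B :: "('n::{t2_space, second_countable_topology}, 'k::euclidean_space) chart set"
    and f :: "'n \<Rightarrow> 'm"
    and S St L :: "'n \<Rightarrow> 'e set"
    and Df nab hl hs sh nabs Dl :: "('n \<Rightarrow> 'e) \<Rightarrow> ('n \<Rightarrow> 'e) \<Rightarrow> 'n \<Rightarrow> 'e"
  assumes "p > 0" and "q > 0"
    and "locally_metallic p q A g J D"
    and "lightlike_submanifold B A g f r"
    and "screen_distribution B A g f S"
    and "screen_transversal_bundle B A g f St"
    and "lightlike_transversal_bundle B A g f r S St L"
    and "induced_connection B A f D Df"
    and "gauss_weingarten B A f St L Df nab hl hs sh nabs Dl"
    and "screen_transversal_anti_invariant B A g J f S St"
  shows "radical_totally_geodesic B A g f nab \<longleftrightarrow>
    (\<forall>W\<in>sections B A f (rad_bundle B A g f). \<forall>U\<in>sections B A f (rad_bundle B A g f).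
       no_component_in_J_screen B A g J f S
         (\<lambda>x. nabs W (\<lambda>y. J (f y) (U y)) x - real p *\<^sub>R hs W U x))"
proof -
  let ?T = "tangent_bundle B A f" and ?N = "normal_bundle B A g f" and ?R = "rad_bundle B A g f"
  note metallic = assms(3)[unfolded locally_metallic_def metallic_semi_riemannian_manifold_def
      semi_riemannian_manifold_def]
  have sm: "smooth_atlas B" "smooth_atlas A" "smooth_map B A f"
    using metallic assms(4) unfolding lightlike_submanifold_def immersed_submanifold_def by auto
  have bil: "bilinear (g y)" and sym: "g y v w = g y w v"
    and linJ: "linear (J y)" and J2: "J y (J y v) = real p *\<^sub>R J y v + real q *\<^sub>R v"
    and gJ: "g y (J y v) w = g y v (J y w)" for y v w
    using metallic by blast+
  have Jsmooth: "(\<lambda>y. J y (X y)) \<in> vector_fields A" if "X \<in> vector_fields A" for X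
    using metallic that by blast
  have "D X (\<lambda>y. J y (Y y)) y - J y (D X Y y) = 0"
    if "X \<in> vector_fields A" "Y \<in> vector_fields A" for X Y y
    using metallic that by blast
  then have par: "D X (\<lambda>y. J y (Y y)) y = J y (D X Y y)"
    if "X \<in> vector_fields A" "Y \<in> vector_fields A" for X Y y
    using that by (simp only: right_minus_eq)
  note g_simps = bilinear_ladd[OF bil] bilinear_radd[OF bil] bilinear_lsub[OF bil]
    bilinear_lmul[OF bil] bilinear_rmul[OF bil] bilinear_lneg[OF bil]
  have S: "complement_in (?T x) (S x) (?R x)" and St: "complement_in (?N x) (St x) (?R x)"
    and ndS: "nondegenerate_on (g (f x)) (S x)" for x
    using assms(5,6) unfolding screen_distribution_def screen_transversal_bundle_def by auto
  have ST: "S x \<subseteq> ?T x" and StN: "St x \<subseteq> ?N x" and RT: "?R x \<subseteq> ?T x" and RN: "?R x \<subseteq> ?N x"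
    and S0: "0 \<in> S x" for x
  proof -
    show "S x \<subseteq> ?T x" "0 \<in> S x" using S[of x] unfolding complement_in_def by force+
    show "St x \<subseteq> ?N x" using St[of x] unfolding complement_in_def by force
  qed (auto simp: rad_bundle_def)
  have NT: "g (f x) v w = 0" if "v \<in> ?N x" "w \<in> ?T x" for x v w
    using that unfolding normal_bundle_def by auto
  have LS: "g (f x) v w = 0" if "v \<in> L x" "w \<in> S x \<union> St x" for x v w
    using assms(7) that unfolding lightlike_transversal_bundle_def by auto
  have JSt: "J (f x) v \<in> St x" if "v \<in> S x \<union> ?R x" for x v
    using assms(10) that unfolding screen_transversal_anti_invariant_def by blast
  have RT_sections: "X \<in> sections B A f ?T" if "X \<in> sections B A f ?R" for X
    using that RT unfolding sections_def by blast
  \<comment> \<open>The normal components of the Gauss and Weingarten formulas, compared through \<open>J\<close>.\<close>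
  have key: "g (f x) (nabs W (\<lambda>y. J (f y) (U y)) x - real p *\<^sub>R hs W U x) (J (f x) z)
      = real q * g (f x) (nab W U x) z"
    if W: "W \<in> sections B A f ?R" and U: "U \<in> sections B A f ?R" and z: "z \<in> S x" for W U x z
  proof -
    let ?g = "g (f x)" and ?J = "J (f x)" and ?JU = "\<lambda>y. J (f y) (U y)"
    have Us: "section_on B A f UNIV U" using U unfolding sections_def by simp
    have JU: "?JU \<in> sections B A f St"
      using tensor_section[OF sm linJ Jsmooth Us] U JSt unfolding sections_def by blast
    note W' = RT_sections[OF W] and U' = RT_sections[OF U]
    have gauss: "Df W U x = nab W U x + hl W U x + hs W U x"
      "nab W U x \<in> ?T x" "hl W U x \<in> L x" "hs W U x \<in> St x"
      using assms(9) W' U' unfolding gauss_weingarten_def Let_def sections_def by auto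
    have weing: "Df W ?JU x = - sh ?JU W x + nabs W ?JU x + Dl W ?JU x"
      "sh ?JU W x \<in> ?T x" "Dl W ?JU x \<in> L x"
      using assms(9) W' JU unfolding gauss_weingarten_def Let_def sections_def by auto
    have Jz: "?J z \<in> St x" using JSt z by blast
    have T_Jz: "?g v (?J z) = 0" if "v \<in> ?T x" for v
      using NT[of "?J z" x v] StN Jz that sym by (metis subsetD)
    have "?g (nabs W ?JU x) (?J z) = ?g (Df W ?JU x) (?J z)"
      using T_Jz[OF weing(2)] LS[OF weing(3)] Jz by (simp add: weing(1) g_simps)
    also have "\<dots> = ?g (Df W U x) (?J (?J z))"
      using induced_connection_parallel[OF sm assms(8) W' linJ Jsmooth par Us] gJ by simp
    also have "\<dots> = real p * ?g (Df W U x) (?J z) + real q * ?g (Df W U x) z"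
      by (simp add: J2 g_simps)
    also have "?g (Df W U x) (?J z) = ?g (hs W U x) (?J z)"
      using T_Jz[OF gauss(2)] LS[OF gauss(3)] Jz by (simp add: gauss(1) g_simps)
    also have "?g (Df W U x) z = ?g (nab W U x) z"
      using LS[OF gauss(3)] NT[of "hs W U x" x z] StN[of x] ST[of x] gauss(4) z
      by (auto simp: gauss(1) g_simps)
    finally show ?thesis by (simp add: g_simps)
  qed
  show ?thesis
  proof
    assume geo: "radical_totally_geodesic B A g f nab"
    show "\<forall>W\<in>sections B A f ?R. \<forall>U\<in>sections B A f ?R. no_component_in_J_screen B A g J f S
         (\<lambda>x. nabs W (\<lambda>y. J (f y) (U y)) x - real p *\<^sub>R hs W U x)"
      unfolding no_component_in_J_screen_def
    proof (intro ballI allI)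
      fix W U Z x
      assume WU: "W \<in> sections B A f ?R" "U \<in> sections B A f ?R" and "Z \<in> sections B A f S"
      then have Z: "Z x \<in> S x" unfolding sections_def by blast
      have "nab W U x \<in> ?R x"
        using geo WU unfolding radical_totally_geodesic_def sections_def by blast
      then have "g (f x) (nab W U x) (Z x) = 0" using NT RN ST Z by blast
      then show "g (f x) (nabs W (\<lambda>y. J (f y) (U y)) x - real p *\<^sub>R hs W U x) (J (f x) (Z x)) = 0"
        using key[OF WU Z] by simp
    qed
  next
    assume no: "\<forall>W\<in>sections B A f ?R. \<forall>U\<in>sections B A f ?R. no_component_in_J_screen B A g J f S
         (\<lambda>x. nabs W (\<lambda>y. J (f y) (U y)) x - real p *\<^sub>R hs W U x)"
    show "radical_totally_geodesic B A g f nab"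
      unfolding radical_totally_geodesic_def
    proof (intro ballI)
      fix W U assume WU: "W \<in> sections B A f ?R" "U \<in> sections B A f ?R"
      have nab: "nab W U \<in> sections B A f ?T"
        using assms(9) RT_sections[OF WU(1)] RT_sections[OF WU(2)]
        unfolding gauss_weingarten_def Let_def by blast
      have "nab W U x \<in> ?R x" for x
      proof -
        \<comment> \<open>The hypothesis concerns global sections of \<open>S\<close>; it yields orthogonality to the whole fibre.\<close>
        have orth: "g (f x) (nab W U x) z = 0" if z: "z \<in> S x" for z
        proof -
          obtain k where k: "subbundle B A f S k"
            using assms(5) unfolding screen_distribution_def by blast
          have lin: "linear (g (f x) (nab W U x))"
            using bil[of "f x"] unfolding bilinear_def by blast
          have "g (f x) (nab W U x) (Z x) = 0" if Z: "Z \<in> sections B A f S" for Z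
          proof -
            have "Z x \<in> S x" using Z unfolding sections_def by blast
            from key[OF WU this] show ?thesis
              using no WU Z assms(2) unfolding no_component_in_J_screen_def by simp
          qed
          then show ?thesis by (rule linear_vanishes_if_on_sections[OF sm k S0 lin _ z])
        qed
        have "nab W U x \<in> ?T x" using nab unfolding sections_def by blast
        then obtain s \<rho> where s: "s \<in> S x" and \<rho>: "\<rho> \<in> ?R x" and eq: "nab W U x = s + \<rho>"
          using S[of x] unfolding complement_in_def by blast
        have "g (f x) s z = 0" if z: "z \<in> S x" for z
        proof -
          have "g (f x) \<rho> z = 0" using NT RN ST \<rho> z by blast
          then show ?thesis using orth[OF z] by (simp add: eq g_simps)
        qed
        then have "s = 0" using ndS s unfolding nondegenerate_on_def by blast
        then show ?thesis using eq \<rho> by simp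
      qed
      then show "nab W U \<in> sections B A f ?R" using nab unfolding sections_def by blast
    qed
  qed
qed

end
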